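(* Let $K$ be a field with algebraic closure $\overline K$, and let $A,B\in K[x,y,z]$ be homogeneous polynomials of degrees $m$ and $n$ respectively, with no nonconstant common factor. Then in $\overline K\mathbb P^2$ the curves $A=0$ and $B=0$ intersect in exactly $mn$ points, counting multiplicities; that is, $$\sum_{\mathbf P\in \overline K\mathbb P^2} i_{\mathbf P}(A,B)=mn,$$ where $i_{\mathbf P}(A,B)$ denotes the intersection multiplicity of $A$ and $B$ at $\mathbf P$.
   Context: $\overline K\mathbb P^2$ is the projective plane over $\overline K$: the set of equivalence classes of nonzero points of $\overline K^3$, two points being equivalent if each is a scalar multiple of the other. A homogeneous polynomial of degree $m$ in $K[x,y,z]$ is a (nonzero) polynomial all of whose terms have total degree $m$; $\partial S$ denotes the total degree of a homogeneous polynomial $S$, and the zero polynomial is regarded as homogeneous of every degree. A homogeneous polynomial $A$ is identified with the curve $A=0$ in $\overline K\mathbb P^2$. Intersection multiplicity: for $\mathbf P\in\overline K\mathbb P^2$, the local ring of rational functions of degree $0$ at $\mathbf P$ is $$R_{\mathbf P}=\left\{\frac{S}{T}: S,T\in\overline K[x,y,z],\ \partial S=\partial T,\ T(\mathbf P)\ne 0\right\},$$ where all polynomials are homogeneous. For $A,B\in K[x,y,z]$ homogeneous with no nonconstant common factor, let $$(A,B)_{\mathbf P}=\left\{\frac{S}{T}\in R_{\mathbf P}: S=MA+NB,\ M,N,T\in\overline K[x,y,z],\ T(\mathbf P)\neq 0\right\}$$ (again with all polynomials homogeneous), which is the ideal generated by $A$ and $B$ in $R_{\mathbf P}$. The intersection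 multiplicity $i_{\mathbf P}(A,B)$ is the dimension of the $\overline K$-vector space $R_{\mathbf P}/(A,B)_{\mathbf P}$ (so it is $0$ if $(A,B)_{\mathbf P}=R_{\mathbf P}$). *)

theory Defs
  imports
    "HOL-Computational_Algebra.Computational_Algebra"
    "HOL-Algebra.Algebra"
    "HOL-Algebra.Algebraic_Closure_Type"
    "HOL-Library.Extended_Nat"
begin

(* K[x,y,z] is the iterated polynomial ring K[x][y][z]: the coefficient of
   x^i y^j z^k in p is coeff (coeff (coeff p k) j) i. *)
type_synonym 'a poly3 = "'a poly poly poly"

definition coeff3 :: "'a::zero poly3 \<Rightarrow> nat \<Rightarrow> nat \<Rightarrow> nat \<Rightarrow> 'a" where
  "coeff3 p i j k = Polynomial.coeff (Polynomial.coeff (Polynomial.coeff p k) j) i"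

definition const3 :: "'a::zero \<Rightarrow> 'a poly3" where
  "const3 c = [:[:[:c:]:]:]"

definition eval3 :: "'a::comm_semiring_0 poly3 \<Rightarrow> 'a \<times> 'a \<times> 'a \<Rightarrow> 'a" where
  "eval3 p = (\<lambda>(x, y, z). poly (poly (poly p [:[:z:]:]) [:y:]) x)"

definition map_poly3 :: "('a::zero \<Rightarrow> 'b::zero) \<Rightarrow> 'a poly3 \<Rightarrow> 'b poly3" where
  "map_poly3 f = map_poly (map_poly (map_poly f))"

(* The zero polynomial is homogeneous of every degree. *)
definition homogeneous :: "nat \<Rightarrow> 'a::zero poly3 \<Rightarrow> bool" where
  "homogeneous d p \<longleftrightarrow> (\<forall>i j k. coeff3 p i j k \<noteq> 0 \<longrightarrow> i + j + k = d)"

definition no_nonconst_common_factor :: "'a::comm_semiring_1 poly3 \<Rightarrow> 'a poly3 \<Rightarrow> bool" where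
  "no_nonconst_common_factor A B \<longleftrightarrow> (\<forall>D. D dvd A \<and> D dvd B \<longrightarrow> D \<in> range const3)"

definition scale3 :: "'a::times \<Rightarrow> 'a \<times> 'a \<times> 'a \<Rightarrow> 'a \<times> 'a \<times> 'a" where
  "scale3 c = (\<lambda>(x, y, z). (c * x, c * y, c * z))"

definition proj_rel :: "(('a::field \<times> 'a \<times> 'a) \<times> ('a \<times> 'a \<times> 'a)) set" where
  "proj_rel = {(u, v). u \<noteq> (0, 0, 0) \<and> v \<noteq> (0, 0, 0) \<and>
                       (\<exists>c. v = scale3 c u) \<and> (\<exists>c. u = scale3 c v)}"

definition proj_plane :: "('a::field \<times> 'a \<times> 'a) set set" where
  "proj_plane = (UNIV - {(0, 0, 0)}) // proj_rel"

(* For homogeneous T the condition does not depend on the representative of P. *)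
definition nonvanishing_at :: "'a::field poly3 \<Rightarrow> ('a \<times> 'a \<times> 'a) set \<Rightarrow> bool" where
  "nonvanishing_at T P \<longleftrightarrow> (\<forall>v\<in>P. eval3 T v \<noteq> 0)"

definition local_ring :: "('a::field \<times> 'a \<times> 'a) set \<Rightarrow> 'a poly3 fract ring" where
  "local_ring P = ring_of_type_algebra \<lparr>carrier :=
     {Fract S T | S T d. homogeneous d S \<and> homogeneous d T \<and> nonvanishing_at T P}\<rparr>"

definition local_ideal ::
  "('a::field \<times> 'a \<times> 'a) set \<Rightarrow> 'a poly3 \<Rightarrow> 'a poly3 \<Rightarrow> 'a poly3 fract set" where
  "local_ideal P A B =
     {Fract S T | S T M N d e f. homogeneous d S \<and> homogeneous d T \<and> nonvanishing_at T P \<and>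
        homogeneous e M \<and> homogeneous f N \<and> S = M * A + N * B}"

definition local_quotient ::
  "('a::field \<times> 'a \<times> 'a) set \<Rightarrow> 'a poly3 \<Rightarrow> 'a poly3 \<Rightarrow> 'a poly3 fract set ring" where
  "local_quotient P A B = local_ring P Quot local_ideal P A B"

(* The image of the ground field in the quotient algebra. Multiplication by its elements is
   scalar multiplication, so the vector space dimension can be taken with respect to it;
   if the ideal is the whole ring, then the image and the quotient are zero, and the
   dimension is 0. *)
definition quotient_scalars ::
  "('a::field \<times> 'a \<times> 'a) set \<Rightarrow> 'a poly3 \<Rightarrow> 'a poly3 \<Rightarrow> 'a poly3 fract set set" where
  "quotient_scalars P A B =
     range (\<lambda>c. local_ideal P A B +>\<^bsub>local_ring P\<^esub> Fract (const3 c) 1)"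

definition intersection_mult ::
  "('a::field \<times> 'a \<times> 'a) set \<Rightarrow> 'a poly3 \<Rightarrow> 'a poly3 \<Rightarrow> enat" where
  "intersection_mult P A B =
     (let Q = local_quotient P A B; k = quotient_scalars P A B in
      if ring.finite_dimension Q k (carrier Q)
      then enat (ring.dim Q k (carrier Q)) else \<infinity>)"

end

theory Submission
  imports Defs
begin

text \<open>Write N(A, B) for the sum of the intersection multiplicities of A and B over all points of the
  plane. The proof computes N(A, B) by running the Euclidean algorithm on A and B as polynomials
  in z. It uses three facts about the ideals (A, B) of the local rings: they are symmetric in A and
  B, they do not change when a multiple of A is added to B, and for A coprime to B multiplication
  by B gives an exact sequence
  0 \<rightarrow> R/(A, C) \<rightarrow> R/(A, BC) \<rightarrow> R/(A, B) \<rightarrow> 0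
  (lemma \<open>local_ideal_mult_exact\<close>). Exactness rests on unique factorization alone: if B divides MA
  then it divides M. Summation over all points gives N(A, B) = N(B, A), N(A, B + CA) = N(A, B) and
  N(A, BC) = N(A, B) + N(A, C), and the product of the degrees obeys the same rules.

  For the Euclidean step let B have the smaller z-degree, and let c be its leading coefficient, a
  form in x and y. A suitable difference cA - QB has a smaller z-degree than A, and
  N(A, B) = N(cA - QB, B) - N(c, B). To keep c coprime to B, the content of B is split off
  beforehand (lemma \<open>bezout_euclid_step\<close>).
  The recursion ends with forms in x and y. Over an algebraically closed field these are products
  of lines through (0 : 0 : 1). On such a line L every nonconstant form A has a zero, so A is
  congruent to FL' modulo L for a second line L' through that zero and a form F; then
  N(L, A) = N(L, F) + N(L, L'), and by induction everything is reduced to two lines, which meet in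
  one point with multiplicity one (lemmas \<open>total_intersection_vertical_line\<close> and
  \<open>total_intersection_eq_1\<close>).

  Two things surround this computation. Dimensions of quotients are expressed by chains of
  subspaces between the ideal and the local ring (\<open>codim\<close>), in which each step adjoins one vector;
  such chains can be concatenated, cut at an intermediate subspace and transported along linear
  maps, so that finiteness is proved together with the values. And forms without a common factor
  over K must have none over the algebraic closure: a linear dependence over the closure splits
  along a K-basis into dependences over K (lemma \<open>coprime_map_to_ac\<close>).\<close>

hide_const (open) UnivPoly.coeff UnivPoly.monom Module.smult

section \<open>Forms in three variables\<close>

abbreviation monom3 :: "'a::zero \<Rightarrow> nat \<Rightarrow> nat \<Rightarrow> nat \<Rightarrow> 'a poly3" where
  "monom3 c i j k \<equiv> monom (monom (monom c i) j) k"

lemma poly3_eqI: "(\<And>i j k. coeff3 p i j k = coeff3 q i j k) \<Longrightarrow> p = q"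
  by (auto simp: coeff3_def poly_eq_iff)

lemma coeff3_0 [simp]: "coeff3 0 i j k = 0"
  by (simp add: coeff3_def)

lemma nonzero_coeff3:
  assumes "p \<noteq> 0" obtains i j k where "coeff3 p i j k \<noteq> 0"
  using assms poly3_eqI[of p 0] by (metis coeff3_0)

lemma coeff3_add [simp]: "coeff3 (p + q) i j k = coeff3 p i j k + coeff3 q i j k"
  by (simp add: coeff3_def)

lemma coeff3_diff [simp]:
  fixes p :: "'a::ab_group_add poly3"
  shows "coeff3 (p - q) i j k = coeff3 p i j k - coeff3 q i j k"
  by (simp add: coeff3_def)

lemma coeff3_sum: "coeff3 (sum f S) i j k = (\<Sum>s\<in>S. coeff3 (f s) i j k)"
  by (simp add: coeff3_def coeff_sum)

lemma coeff3_mult: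
  "coeff3 (p * q) i j k =
     (\<Sum>c\<le>k. \<Sum>b\<le>j. \<Sum>a\<le>i. coeff3 p a b c * coeff3 q (i - a) (j - b) (k - c))"
  by (simp add: coeff3_def coeff_mult coeff_sum)

lemma coeff3_monom3:
  "coeff3 (monom3 c i j k) i' j' k' = (if i = i' \<and> j = j' \<and> k = k' then c else 0)"
  by (simp add: coeff3_def)

lemma finite_coeff3: "finite {(i, j, k). coeff3 p i j k \<noteq> 0}"
proof -
  have "{(i, j, k). coeff3 p i j k \<noteq> 0} \<subseteq>
     (\<Union>k\<in>{..degree p}. \<Union>j\<in>{..degree (coeff p k)}. \<Union>i\<in>{..degree (coeff (coeff p k) j)}. {(i, j, k)})"
    by (auto simp: coeff3_def intro!: le_degree)
  then show ?thesis by (rule finite_subset) auto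
qed

text \<open>The projection to the components with degrees in D. A set of degrees in place of a single one
  makes the complementary projection available as well.\<close>

definition hpart :: "nat set \<Rightarrow> 'a::comm_monoid_add poly3 \<Rightarrow> 'a poly3" where
  "hpart D p = (\<Sum>(i, j, k)\<in>{(i, j, k). coeff3 p i j k \<noteq> 0}.
     if i + j + k \<in> D then monom3 (coeff3 p i j k) i j k else 0)"

lemma coeff3_hpart: "coeff3 (hpart D p) i j k = (if i + j + k \<in> D then coeff3 p i j k else 0)"
proof -
  let ?S = "{(i, j, k). coeff3 p i j k \<noteq> 0}"
  have "coeff3 (hpart D p) i j k =
      (\<Sum>s\<in>?S. if s = (i, j, k) then (if i + j + k \<in> D then coeff3 p i j k else 0) else 0)"
    unfolding hpart_def coeff3_sum
    by (rule sum.cong) (auto simp: coeff3_monom3 split: prod.splits)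
  then show ?thesis
    by (auto simp: sum.delta[OF finite_coeff3])
qed

lemma monom3_expansion:
  "p = (\<Sum>(i, j, k)\<in>{(i, j, k). coeff3 p i j k \<noteq> 0}. monom3 (coeff3 p i j k) i j k)"
  (is "p = ?s")
proof -
  have "p = hpart UNIV p" by (rule poly3_eqI) (simp add: coeff3_hpart)
  also have "\<dots> = ?s" by (simp add: hpart_def)
  finally show ?thesis .
qed

text \<open>Homogeneity generalized to a set of admissible total degrees. It describes sums of several
  components, and with D = {e. e + m = d} the component of degree d - m, which is zero for d < m.\<close>

definition tdeg_in :: "nat set \<Rightarrow> 'a::zero poly3 \<Rightarrow> bool" where
  "tdeg_in D p \<longleftrightarrow> (\<forall>i j k. coeff3 p i j k \<noteq> 0 \<longrightarrow> i + j + k \<in> D)"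

lemma homogeneous_tdeg_in: "homogeneous d p \<longleftrightarrow> tdeg_in {d} p"
  by (auto simp: homogeneous_def tdeg_in_def)

lemma tdeg_in_mono: "tdeg_in D p \<Longrightarrow> D \<subseteq> E \<Longrightarrow> tdeg_in E p"
  by (auto simp: tdeg_in_def)

lemma tdeg_in_add: "tdeg_in D p \<Longrightarrow> tdeg_in D q \<Longrightarrow> tdeg_in D (p + q)"
  by (simp add: tdeg_in_def) (metis add_0)

lemma tdeg_in_diff: "tdeg_in D p \<Longrightarrow> tdeg_in D q \<Longrightarrow> tdeg_in D (p - (q :: 'a::ab_group_add poly3))"
  by (simp add: tdeg_in_def) (metis diff_zero)

lemma tdeg_in_mult:
  assumes "tdeg_in D p" "tdeg_in E q"
  shows "tdeg_in {d + e | d e. d \<in> D \<and> e \<in> E} (p * q)"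
  unfolding tdeg_in_def
proof (intro allI impI)
  fix i j k assume "coeff3 (p * q) i j k \<noteq> 0"
  then obtain a b c where le: "a \<le> i" "b \<le> j" "c \<le> k"
    and nz: "coeff3 p a b c * coeff3 q (i - a) (j - b) (k - c) \<noteq> 0"
    unfolding coeff3_mult by (metis (no_types, lifting) atMost_iff sum.not_neutral_contains_not_neutral)
  from nz assms have "a + b + c \<in> D" "(i - a) + (j - b) + (k - c) \<in> E"
    unfolding tdeg_in_def by (metis mult_zero_left, metis mult_zero_right)
  moreover have "i + j + k = (a + b + c) + ((i - a) + (j - b) + (k - c))"
    using le by simp
  ultimately show "i + j + k \<in> {d + e | d e. d \<in> D \<and> e \<in> E}" by blast
qed

lemma tdeg_in_hpart: "tdeg_in D (hpart D p)"
  by (simp add: tdeg_in_def coeff3_hpart)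

lemma hpart_split: "hpart D p + hpart (- D) p = p"
  by (rule poly3_eqI) (simp add: coeff3_hpart)

lemma tdeg_in_disjoint: "tdeg_in D p \<Longrightarrow> tdeg_in E p \<Longrightarrow> D \<inter> E = {} \<Longrightarrow> p = 0"
  by (rule poly3_eqI) (simp add: tdeg_in_def, blast)

lemma homogeneous_0 [simp]: "homogeneous d 0"
  by (simp add: homogeneous_def)

lemma homogeneous_add: "homogeneous d p \<Longrightarrow> homogeneous d q \<Longrightarrow> homogeneous d (p + q)"
  by (simp add: homogeneous_tdeg_in tdeg_in_add)

lemma homogeneous_diff:
  "homogeneous d p \<Longrightarrow> homogeneous d q \<Longrightarrow> homogeneous d (p - (q :: 'a::ab_group_add poly3))"
  by (simp add: homogeneous_tdeg_in tdeg_in_diff)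

lemma homogeneous_minus: "homogeneous d p \<Longrightarrow> homogeneous d (- (p :: 'a::ab_group_add poly3))"
  using homogeneous_diff[of d 0 p] by simp

lemma homogeneous_mult:
  assumes "homogeneous d p" "homogeneous e q" shows "homogeneous (d + e) (p * q)"
  using tdeg_in_mult[of "{d}" p "{e}" q] assms by (simp add: homogeneous_tdeg_in)

lemma homogeneous_monom3: "homogeneous (i + j + k) (monom3 c i j k)"
  by (auto simp: homogeneous_def coeff3_monom3 split: if_splits)

lemma const3_monom3: "const3 c = monom3 c 0 0 0"
  by (simp add: const3_def monom_0)

lemma homogeneous_const3 [simp]: "homogeneous 0 (const3 c)"
  using homogeneous_monom3[of 0 0 0 c] by (simp add: const3_monom3)

lemma homogeneous_const3_mult:
  "homogeneous d p \<Longrightarrow> homogeneous d (const3 c * p)"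
  using homogeneous_mult[of 0 "const3 c" d p] by simp

lemma one_const3: "(1 :: 'a::comm_semiring_1 poly3) = const3 1"
  by (simp add: const3_def one_pCons)

lemma homogeneous_1 [simp]: "homogeneous 0 (1 :: 'a::comm_semiring_1 poly3)"
  by (simp add: one_const3)

lemma homogeneous_power: "homogeneous d p \<Longrightarrow> homogeneous (d * n) (p ^ n)"
  for p :: "'a::comm_semiring_1 poly3"
  by (induction n) (auto dest: homogeneous_mult)

lemma homogeneous_unique: "homogeneous d p \<Longrightarrow> homogeneous e p \<Longrightarrow> p \<noteq> 0 \<Longrightarrow> d = e"
  using tdeg_in_disjoint[of "{d}" p "{e}"] by (auto simp: homogeneous_tdeg_in)

text \<open>In an expression of a form by two forms, the components of the cofactors in the wrong
  degrees cancel, so the cofactors can be taken to be forms of the degrees that fit.\<close>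

lemma homogeneous_cofactors:
  fixes A B :: "'a::comm_ring_1 poly3"
  assumes hom: "homogeneous d S" "homogeneous m A" "homogeneous n B" and S: "S = M * A + N * B"
  obtains M' N' where "tdeg_in {e. e + m = d} M'" "tdeg_in {e. e + n = d} N'" "S = M' * A + N' * B"
proof -
  let ?D = "{e. e + m = d}" and ?E = "{e. e + n = d}"
  define R where "R = hpart (- ?D) M * A + hpart (- ?E) N * B"
  have eq: "S = hpart ?D M * A + hpart ?E N * B + R"
  proof -
    have "S = (hpart ?D M + hpart (- ?D) M) * A + (hpart ?E N + hpart (- ?E) N) * B"
      by (simp only: hpart_split S)
    then show ?thesis by (simp add: R_def algebra_simps)
  qed
  have "tdeg_in (- {d}) R"
    unfolding R_def using hom
    by (intro tdeg_in_add tdeg_in_mono[OF tdeg_in_mult[OF tdeg_in_hpart]])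
       (auto simp: homogeneous_tdeg_in)
  moreover have "tdeg_in {d} (hpart ?D M * A + hpart ?E N * B)" using hom
    by (intro tdeg_in_add tdeg_in_mono[OF tdeg_in_mult[OF tdeg_in_hpart]])
       (auto simp: homogeneous_tdeg_in)
  then have "tdeg_in {d} (S - (hpart ?D M * A + hpart ?E N * B))"
    using hom by (intro tdeg_in_diff) (auto simp: homogeneous_tdeg_in)
  then have "tdeg_in {d} R" by (simp add: eq)
  ultimately have "R = 0" using tdeg_in_disjoint by blast
  with eq show ?thesis
    using that[OF tdeg_in_hpart tdeg_in_hpart] by simp
qed

lemma tdeg_in_eq_homogeneous:
  "tdeg_in {e. e + m = d} M \<Longrightarrow> m \<le> d \<Longrightarrow> homogeneous (d - m) M"
  "tdeg_in {e. e + m = d} M \<Longrightarrow> d < m \<Longrightarrow> M = 0"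
proof -
  assume *: "tdeg_in {e. e + m = d} M"
  show "homogeneous (d - m) M" if "m \<le> d"
    unfolding homogeneous_def using * that by (fastforce simp: tdeg_in_def)
  show "M = 0" if "d < m"
    using * that by (intro poly3_eqI) (fastforce simp: tdeg_in_def)
qed

lemma tdeg_in_exists_homogeneous:
  assumes "tdeg_in {e. e + m = d} M" obtains e where "homogeneous e M"
  using tdeg_in_eq_homogeneous[OF assms] by (metis homogeneous_0 not_le)

text \<open>If d and e are the largest degrees that occur in p and q, or the smallest ones, then d + e arises
  from no other pair of degrees. So nothing cancels the product of the two extreme components.\<close>

lemma extreme_degrees_mult:
  fixes p q :: "'a::idom poly3"
  assumes P: "tdeg_in P p" "hpart {d} p \<noteq> 0" and Q: "tdeg_in Q q" "hpart {e} q \<noteq> 0"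
    and ext: "\<And>a b. a \<in> P \<Longrightarrow> b \<in> Q \<Longrightarrow> a + b = d + e \<Longrightarrow> a = d \<and> b = e"
  shows "hpart {d + e} (p * q) \<noteq> 0"
proof -
  define p' q' where "p' = hpart (-{d}) p" and "q' = hpart (-{e}) q"
  have p: "p = hpart {d} p + p'" and q: "q = hpart {e} q + q'"
    unfolding p'_def q'_def by (simp_all add: hpart_split)
  have p': "tdeg_in (P - {d}) p'" and q': "tdeg_in (Q - {e}) q'"
    using P(1) Q(1) by (auto simp: p'_def q'_def tdeg_in_def coeff3_hpart)
  have eq: "p * q = hpart {d} p * hpart {e} q + (p' * q + hpart {d} p * q')"
  proof -
    have "p * q = (hpart {d} p + p') * q" using p by simp
    also have "\<dots> = hpart {d} p * q + p' * q" by (simp add: algebra_simps)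
    also have "hpart {d} p * q = hpart {d} p * (hpart {e} q + q')" using q by simp
    finally show ?thesis by (simp add: algebra_simps)
  qed
  have tt: "tdeg_in (- {d + e}) (p' * q + hpart {d} p * q')"
  proof (intro tdeg_in_add)
    show "tdeg_in (- {d + e}) (p' * q)"
      by (rule tdeg_in_mono[OF tdeg_in_mult[OF p' Q(1)]]) (use ext in auto)
    show "tdeg_in (- {d + e}) (hpart {d} p * q')"
      by (rule tdeg_in_mono[OF tdeg_in_mult[OF tdeg_in_hpart q']]) auto
  qed
  have "tdeg_in {d + e} (hpart {d} p * hpart {e} q)"
    by (rule tdeg_in_mono[OF tdeg_in_mult[OF tdeg_in_hpart tdeg_in_hpart]]) auto
  moreover have "hpart {d} p * hpart {e} q \<noteq> 0" using P Q by simp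
  ultimately obtain i j k where ijk: "coeff3 (hpart {d} p * hpart {e} q) i j k \<noteq> 0" "i + j + k = d + e"
    by (metis coeff3_0 poly3_eqI singletonD tdeg_in_def)
  have "coeff3 (p' * q + hpart {d} p * q') i j k = 0"
    using tt ijk(2) unfolding tdeg_in_def by (metis ComplD singletonI)
  then have "coeff3 (p * q) i j k \<noteq> 0"
    using ijk(1) by (subst eq) simp
  then have "coeff3 (hpart {d + e} (p * q)) i j k \<noteq> 0"
    using ijk by (simp add: coeff3_hpart)
  then show ?thesis by auto
qed

text \<open>The largest degrees of the factors add up, and so do the smallest ones. In a form both sums are
  equal, which leaves only one degree for each factor.\<close>

lemma homogeneous_factor:
  fixes p q :: "'a::idom poly3"
  assumes "homogeneous n (p * q)" "p * q \<noteq> 0"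
  obtains d e where "homogeneous d p" "homogeneous e q" "n = d + e"
proof -
  define T where "T = (\<lambda>r::'a poly3. {i + j + k | i j k. coeff3 r i j k \<noteq> 0})"
  have T: "tdeg_in (T r) r" for r by (auto simp: T_def tdeg_in_def)
  have fin: "finite (T r)" for r
  proof -
    have "T r = (\<lambda>(i, j, k). i + j + k) ` {(i, j, k). coeff3 r i j k \<noteq> 0}"
      by (force simp: T_def)
    then show ?thesis by (simp only: finite_imageI[OF finite_coeff3])
  qed
  have ne: "T r \<noteq> {}" if "r \<noteq> 0" for r
    using nonzero_coeff3[OF that] by (fastforce simp: T_def)
  have hp: "hpart {d} r \<noteq> 0" if d: "d \<in> T r" for d r
  proof
    assume "hpart {d} r = 0"
    moreover obtain i j k where "d = i + j + k" "coeff3 r i j k \<noteq> 0" using d by (auto simp: T_def)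
    ultimately show False using coeff3_hpart[of "{d}" r i j k] by simp
  qed
  have n: "d = n" if "hpart {d} (p * q) \<noteq> 0" for d
  proof -
    obtain i j k where "coeff3 (hpart {d} (p * q)) i j k \<noteq> 0"
      using \<open>hpart {d} (p * q) \<noteq> 0\<close> by (rule nonzero_coeff3)
    then show ?thesis using assms(1) by (auto simp: coeff3_hpart homogeneous_def split: if_splits)
  qed
  have pq: "p \<noteq> 0" "q \<noteq> 0" using assms(2) by auto
  have "Max (T p) + Max (T q) = n"
  proof (rule n, rule extreme_degrees_mult[OF T _ T])
    fix a b assume "a \<in> T p" "b \<in> T q" "a + b = Max (T p) + Max (T q)"
    moreover from this have "a \<le> Max (T p)" "b \<le> Max (T q)" using fin by auto
    ultimately show "a = Max (T p) \<and> b = Max (T q)" by linarith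
  qed (use pq fin ne in \<open>auto intro!: hp Max_in\<close>)
  moreover have "Min (T p) + Min (T q) = n"
  proof (rule n, rule extreme_degrees_mult[OF T _ T])
    fix a b assume "a \<in> T p" "b \<in> T q" "a + b = Min (T p) + Min (T q)"
    moreover from this have "a \<ge> Min (T p)" "b \<ge> Min (T q)" using fin by auto
    ultimately show "a = Min (T p) \<and> b = Min (T q)" by linarith
  qed (use pq fin ne in \<open>auto intro!: hp Min_in\<close>)
  moreover have "Min (T p) \<le> Max (T p)" "Min (T q) \<le> Max (T q)"
    using pq fin ne by auto
  ultimately have eq: "Min (T p) = Max (T p)" "Min (T q) = Max (T q)" by linarith+
  have "homogeneous (Max (T r)) r" if "Min (T r) = Max (T r)" for r
    unfolding homogeneous_def
  proof (intro allI impI)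
    fix i j k assume "coeff3 r i j k \<noteq> 0"
    then have "i + j + k \<in> T r" by (auto simp: T_def)
    then show "i + j + k = Max (T r)" using Min_le[OF fin] Max_ge[OF fin] that by (metis le_antisym)
  qed
  with eq show ?thesis using that \<open>Max (T p) + Max (T q) = n\<close> by metis
qed

lemma eval3_0 [simp]: "eval3 0 v = 0"
  by (cases v) (simp add: eval3_def)
lemma eval3_1 [simp]: "eval3 (1 :: 'a::comm_semiring_1 poly3) v = 1"
  by (cases v) (simp add: eval3_def)
lemma eval3_add [simp]: "eval3 (p + q) v = eval3 p v + eval3 q v"
  by (cases v) (simp add: eval3_def)
lemma eval3_diff [simp]: "eval3 (p - q) v = eval3 p v - eval3 (q :: 'a::comm_ring poly3) v"
  by (cases v) (simp add: eval3_def)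
lemma eval3_mult [simp]: "eval3 (p * q) v = eval3 p v * eval3 (q :: 'a::comm_semiring_0 poly3) v"
  by (cases v) (simp add: eval3_def)
lemma eval3_power [simp]: "eval3 (p ^ n) v = eval3 (p :: 'a::comm_semiring_1 poly3) v ^ n"
  by (induction n) simp_all
lemma eval3_sum: "eval3 (sum f S) v = (\<Sum>s\<in>S. eval3 (f s) v)"
  by (induction S rule: infinite_finite_induct) simp_all
lemma eval3_const3 [simp]: "eval3 (const3 c) v = c"
  by (cases v) (simp add: eval3_def const3_def)
lemma eval3_monom3 [simp]:
  "eval3 (monom3 c i j k) (x, y, z) = c * x ^ i * y ^ j * (z :: 'a::comm_semiring_1) ^ k"
  by (simp add: eval3_def poly_monom poly_mult poly_power)

lemma eval3_expansion:
  "eval3 p v = (\<Sum>(i, j, k)\<in>{(i, j, k). coeff3 p i j k \<noteq> 0}.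
     eval3 (monom3 (coeff3 p i j k) i j k) v)"
proof -
  have "eval3 p v = eval3 (\<Sum>(i, j, k)\<in>{(i, j, k). coeff3 p i j k \<noteq> 0}. monom3 (coeff3 p i j k) i j k) v"
    by (simp only: monom3_expansion[of p, symmetric])
  then show ?thesis
    unfolding eval3_sum split_def .
qed

lemma eval3_homogeneous_scale:
  fixes p :: "'a::comm_semiring_1 poly3"
  assumes "homogeneous d p"
  shows "eval3 p (scale3 c v) = c ^ d * eval3 p v"
proof -
  obtain x y z where v: "v = (x, y, z)" by (cases v)
  have "eval3 p (scale3 c v) = (\<Sum>(i, j, k)\<in>{(i, j, k). coeff3 p i j k \<noteq> 0}.
      eval3 (monom3 (coeff3 p i j k) i j k) (c * x, c * y, c * z))"
    unfolding v scale3_def split_conv by (rule eval3_expansion)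
  also have "\<dots> = (\<Sum>(i, j, k)\<in>{(i, j, k). coeff3 p i j k \<noteq> 0}.
      c ^ d * eval3 (monom3 (coeff3 p i j k) i j k) (x, y, z))"
  proof (rule sum.cong[OF refl], clarify)
    fix i j k assume "coeff3 p i j k \<noteq> 0"
    then have "d = i + j + k" using assms by (auto simp: homogeneous_def)
    then show "eval3 (monom3 (coeff3 p i j k) i j k) (c * x, c * y, c * z) =
        c ^ d * eval3 (monom3 (coeff3 p i j k) i j k) (x, y, z)"
      by (simp add: power_mult_distrib power_add algebra_simps)
  qed
  also have "\<dots> = c ^ d * eval3 p v"
    unfolding v by (subst eval3_expansion[of p "(x, y, z)"]) (simp only: sum_distrib_left split_def)
  finally show ?thesis .
qed

abbreviation (input) X3 :: "'a::comm_semiring_1 poly3" where "X3 \<equiv> monom3 1 1 0 0"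
abbreviation (input) Y3 :: "'a::comm_semiring_1 poly3" where "Y3 \<equiv> monom3 1 0 1 0"
abbreviation (input) Z3 :: "'a::comm_semiring_1 poly3" where "Z3 \<equiv> monom3 1 0 0 1"

lemma monom3_factored: "monom3 c i j k = const3 c * X3 ^ i * Y3 ^ j * (Z3 :: 'a::comm_semiring_1 poly3) ^ k"
proof -
  have "X3 ^ i = (monom3 1 i 0 0 :: 'a poly3)" "Y3 ^ j = (monom3 1 0 j 0 :: 'a poly3)" "Z3 ^ k = (monom3 1 0 0 k :: 'a poly3)"
    by (simp_all add: monom_power)
  then show ?thesis by (simp add: const3_monom3 mult_monom del: monom_power)
qed

text \<open>Modulo an ideal that contains x - a u, y - b u and z - c u, a form F of degree d
  is congruent to F(a, b, c) u^d, as one sees on each monomial.\<close>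

lemma homogeneous_cong:
  fixes F :: "'a::comm_ring_1 poly3" and I :: "'a poly3 set"
  assumes hom: "homogeneous d F"
    and zero: "0 \<in> I" and add: "\<And>f g. f \<in> I \<Longrightarrow> g \<in> I \<Longrightarrow> f + g \<in> I"
    and mult: "\<And>f g. f \<in> I \<Longrightarrow> g * f \<in> I"
    and X: "X3 - const3 a * u \<in> I" and Y: "Y3 - const3 b * u \<in> I" and Z: "Z3 - const3 c * u \<in> I"
  shows "F - const3 (eval3 F (a, b, c)) * u ^ d \<in> I"
proof -
  define eqv where "eqv = (\<lambda>f g. f - g \<in> I)"
  have eqv_mult: "eqv (f * f') (g * g')" if "eqv f g" "eqv f' g'" for f f' g g'
  proof -
    have "f * f' - g * g' = f * (f' - g') + g' * (f - g)" by (simp add: algebra_simps)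
    then show ?thesis using that add mult by (simp add: eqv_def)
  qed
  have eqv_refl: "eqv f f" for f using zero by (simp add: eqv_def)
  have eqv_power: "eqv (f ^ n) (g ^ n)" if "eqv f g" for f g n
    by (induction n) (auto intro: eqv_refl eqv_mult that)
  have eqv_sum: "eqv (sum f S) (sum g S)" if "\<And>s. s \<in> S \<Longrightarrow> eqv (f s) (g s)" for f g and S :: "(nat \<times> nat \<times> nat) set"
    using that
  proof (induction S rule: infinite_finite_induct)
    case (insert s S)
    have "(f s + sum f S) - (g s + sum g S) = (f s - g s) + (sum f S - sum g S)" by simp
    moreover have "(f s - g s) + (sum f S - sum g S) \<in> I"
      using insert by (intro add) (auto simp: eqv_def)
    ultimately have "(f s + sum f S) - (g s + sum g S) \<in> I" by (simp only:)
    then show ?case unfolding eqv_def sum.insert[OF insert(1,2)] .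
  qed (auto simp: eqv_refl)
  let ?S = "{(i, j, k). coeff3 F i j k \<noteq> 0}"
  have const3_mult: "const3 (r * s) = const3 r * const3 s" for r s :: 'a by (simp add: const3_def)
  have const3_pow: "const3 (r ^ n) = const3 r ^ n" for r :: 'a and n
    by (induction n) (simp_all add: const3_mult one_const3)
  have const3_sum: "const3 (sum h S) = (\<Sum>s\<in>S. const3 (h s))" for h :: "nat \<times> nat \<times> nat \<Rightarrow> 'a" and S
    by (rule poly3_eqI) (simp add: coeff3_sum const3_monom3 coeff3_monom3)
  have "eqv (\<Sum>(i, j, k)\<in>?S. monom3 (coeff3 F i j k) i j k)
     (\<Sum>(i, j, k)\<in>?S. const3 (coeff3 F i j k * a ^ i * b ^ j * c ^ k) * u ^ d)"
  proof (rule eqv_sum, clarify)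
    fix i j k assume "coeff3 F i j k \<noteq> 0"
    then have d: "d = i + j + k" using hom by (auto simp: homogeneous_def)
    have "eqv (monom3 (coeff3 F i j k) i j k) (const3 (coeff3 F i j k) * (const3 a * u) ^ i * (const3 b * u) ^ j * (const3 c * u) ^ k)"
      using X Y Z by (subst monom3_factored) (intro eqv_mult eqv_power eqv_refl; simp add: eqv_def)
    also have "const3 (coeff3 F i j k) * (const3 a * u) ^ i * (const3 b * u) ^ j * (const3 c * u) ^ k
        = const3 (coeff3 F i j k * a ^ i * b ^ j * c ^ k) * u ^ d"
      by (simp add: d const3_mult const3_pow power_mult_distrib power_add algebra_simps)
    finally show "eqv (monom3 (coeff3 F i j k) i j k) (const3 (coeff3 F i j k * a ^ i * b ^ j * c ^ k) * u ^ d)" .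
  qed
  moreover have "const3 (eval3 F (a, b, c)) * u ^ d
      = (\<Sum>(i, j, k)\<in>?S. const3 (coeff3 F i j k * a ^ i * b ^ j * c ^ k) * u ^ d)"
    unfolding eval3_expansion[of F "(a, b, c)"] const3_sum sum_distrib_right
    by (rule sum.cong) (auto simp only: split_conv eval3_monom3)
  ultimately have "eqv (\<Sum>(i, j, k)\<in>?S. monom3 (coeff3 F i j k) i j k) (const3 (eval3 F (a, b, c)) * u ^ d)"
    by (simp only:)
  then have "eqv F (const3 (eval3 F (a, b, c)) * u ^ d)"
    by (subst (1) monom3_expansion)
  then show ?thesis
    by (simp only: eqv_def)
qed

section \<open>Chains of subspaces\<close>

locale linear_space = vector_space scale
  for scale :: "'k::field \<Rightarrow> 'v::ab_group_add \<Rightarrow> 'v" (infixr \<open>*s\<close> 75)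
begin

definition adjoin :: "'v \<Rightarrow> 'v set \<Rightarrow> 'v set" where
  "adjoin v V = {u + c *s v | u c. u \<in> V}"

text \<open>The relation \<open>codim J n V\<close> says that the quotient V/J has dimension n: V is reached from J by
  adjoining n vectors one at a time, each outside of the space reached before. As a relation it
  includes finiteness, and it refers to subspaces of one space instead of quotients.\<close>

inductive codim :: "'v set \<Rightarrow> nat \<Rightarrow> 'v set \<Rightarrow> bool" for J where
  codim_0: "codim J 0 J"
| codim_Suc: "codim J n V \<Longrightarrow> v \<notin> V \<Longrightarrow> codim J (Suc n) (adjoin v V)"

lemma subset_adjoin: "V \<subseteq> adjoin v V"
proof
  fix u assume "u \<in> V"
  then have "u = u + 0 *s v" "u \<in> V" by auto
  then show "u \<in> adjoin v V" unfolding adjoin_def by blast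
qed

lemma in_adjoin: "subspace V \<Longrightarrow> v \<in> adjoin v V"
  unfolding adjoin_def using subspace_0[of V] scale_one[of v] add_0 by (metis (mono_tags, lifting) mem_Collect_eq)

lemma subspace_adjoin:
  assumes "subspace V" shows "subspace (adjoin v V)"
proof (rule subspaceI)
  show "0 \<in> adjoin v V" using subset_adjoin subspace_0[OF assms] by blast
next
  fix x y assume "x \<in> adjoin v V" "y \<in> adjoin v V"
  then obtain a b c d where "x = a + c *s v" "y = b + d *s v" "a \<in> V" "b \<in> V"
    unfolding adjoin_def by blast
  then have "x + y = (a + b) + (c + d) *s v" "a + b \<in> V"
    using assms by (auto simp: scale_left_distrib algebra_simps subspace_add)
  then show "x + y \<in> adjoin v V" unfolding adjoin_def by blast
next
  fix e x assume "x \<in> adjoin v V"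
  then obtain a c where "x = a + c *s v" "a \<in> V" unfolding adjoin_def by blast
  then have "e *s x = e *s a + (e * c) *s v" "e *s a \<in> V"
    using assms by (auto simp: scale_right_distrib subspace_scale)
  then show "e *s x \<in> adjoin v V" unfolding adjoin_def by blast
qed

lemma adjoin_least: "subspace W \<Longrightarrow> V \<subseteq> W \<Longrightarrow> v \<in> W \<Longrightarrow> adjoin v V \<subseteq> W"
  unfolding adjoin_def by (auto intro!: subspace_add subspace_scale)

lemma adjoin_exchange:
  assumes "subspace V" "u \<in> adjoin v V" "u \<notin> V" shows "adjoin u V = adjoin v V"
proof
  show "adjoin u V \<subseteq> adjoin v V"
    using assms by (intro adjoin_least subspace_adjoin subset_adjoin)
  obtain a c where u: "u = a + c *s v" "a \<in> V" using assms unfolding adjoin_def by blast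
  with assms(3) have "c \<noteq> 0" by auto
  then have "v = inverse c *s (u - a)" by (simp add: u)
  also have "\<dots> \<in> adjoin u V"
    using assms u(2) subset_adjoin[of V u] in_adjoin[of V u]
    by (intro subspace_scale subspace_diff subspace_adjoin) auto
  finally show "adjoin v V \<subseteq> adjoin u V"
    using assms by (intro adjoin_least subspace_adjoin subset_adjoin)
qed

lemma codim_subspace: "codim J n V \<Longrightarrow> subspace J \<Longrightarrow> subspace V"
  by (induction rule: codim.induct) (auto intro: subspace_adjoin)

lemma codim_subset: "codim J n V \<Longrightarrow> J \<subseteq> V"
  by (induction rule: codim.induct) (use subset_adjoin in auto)

lemma codim_trans:
  assumes "codim J n I" "codim I m V" shows "codim J (n + m) V"
  using assms(2,1) by (induction rule: codim.induct) (auto intro: codim.intros)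

lemma codim_0_iff: "codim J 0 V \<longleftrightarrow> V = J"
  by (subst codim.simps) auto

lemma codim_1I: "subspace J \<Longrightarrow> v \<notin> J \<Longrightarrow> V = adjoin v J \<Longrightarrow> codim J 1 V"
  using codim_Suc[OF codim_0] by auto

text \<open>A linear map carries a chain over the preimage of a subspace to a chain over that subspace:
  strict steps stay strict because what the map could identify already lies in the preimage.\<close>

lemma codim_image:
  assumes "codim J' n R" "subspace J" "subspace J'"
    and add: "\<And>x y. f (x + y) = f x + f y" and scale: "\<And>c x. f (c *s x) = c *s f x"
    and J': "\<And>x. x \<in> R \<Longrightarrow> f x \<in> J \<longleftrightarrow> x \<in> J'"
  shows "codim J n {a + f x | a x. a \<in> J \<and> x \<in> R}"
  using assms(1) J'
proof (induction rule: codim.induct)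
  case codim_0
  have "f 0 = 0" using scale[of 0 0] by simp
  then have "{a + f x | a x. a \<in> J \<and> x \<in> J'} = J"
    using codim_0 assms subspace_add[OF assms(2)] subspace_0[OF assms(3)]
    by (auto) (metis add.right_neutral)
  then show ?case by (simp add: codim.codim_0)
next
  case (codim_Suc n V v)
  let ?g = "\<lambda>V. {a + f x | a x. a \<in> J \<and> x \<in> V}"
  have V: "subspace V" "J' \<subseteq> V" using codim_Suc codim_subspace codim_subset assms by auto
  have R: "V \<subseteq> adjoin v V" "v \<in> adjoin v V" by (auto intro: in_adjoin V subsetD[OF subset_adjoin])
  have "codim J n (?g V)" using codim_Suc R by blast
  moreover have "f v \<notin> ?g V"
  proof
    assume "f v \<in> ?g V"
    then obtain a x where ax: "f v = a + f x" "a \<in> J" "x \<in> V" by blast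
    have "f v = f (v - x) + f x" using add[of "v - x" x] by simp
    then have "f (v - x) \<in> J" using ax by simp
    moreover have "v - x \<in> adjoin v V"
      using R ax V by (intro subspace_diff subspace_adjoin) auto
    ultimately have "v - x \<in> V" using codim_Suc.prems V by blast
    then show False using codim_Suc.hyps ax V subspace_add[of V "v - x" x] by simp
  qed
  ultimately have "codim J (Suc n) (adjoin (f v) (?g V))" by (rule codim.codim_Suc)
  moreover have "adjoin (f v) (?g V) = ?g (adjoin v V)"
  proof (intro equalityI subsetI)
    fix y assume "y \<in> adjoin (f v) (?g V)"
    then obtain a x c where *: "y = a + f x + c *s f v" "a \<in> J" "x \<in> V" unfolding adjoin_def by blast
    then have "y = a + f (x + c *s v)" by (simp add: add scale algebra_simps)
    with * show "y \<in> ?g (adjoin v V)" unfolding adjoin_def by blast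
  next
    fix y assume "y \<in> ?g (adjoin v V)"
    then obtain a x c where *: "y = a + f (x + c *s v)" "a \<in> J" "x \<in> V" unfolding adjoin_def by blast
    then have "y = (a + f x) + c *s f v" by (simp add: add scale algebra_simps)
    with * show "y \<in> adjoin (f v) (?g V)" unfolding adjoin_def by blast
  qed
  ultimately show ?case by simp
qed

text \<open>A vector u outside of V is independent of the whole chain from W to V, so adjoining it to every
  member of the chain keeps all steps strict.\<close>

lemma codim_adjoin:
  assumes "codim W n V" "subspace W" "u \<notin> V"
  shows "codim (adjoin u W) n (adjoin u V)"
proof -
  have V: "subspace V" using assms codim_subspace by blast
  have "codim (adjoin u W) n {a + id x | a x. a \<in> adjoin u W \<and> x \<in> V}"
  proof (rule codim_image[OF assms(1)])
    fix x assume x: "x \<in> V"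
    have "x \<in> W" if "x \<in> adjoin u W"
    proof (rule ccontr)
      assume "x \<notin> W"
      then have "adjoin x W = adjoin u W" using adjoin_exchange that assms by blast
      moreover have "adjoin x W \<subseteq> V" using x V codim_subset[OF assms(1)] by (intro adjoin_least)
      ultimately show False using in_adjoin assms by blast
    qed
    then show "id x \<in> adjoin u W \<longleftrightarrow> x \<in> W" using subset_adjoin by auto
  qed (use assms subspace_adjoin in auto)
  moreover have "{a + id x | a x. a \<in> adjoin u W \<and> x \<in> V} = adjoin u V"
  proof (intro equalityI subsetI)
    fix y assume "y \<in> {a + id x | a x. a \<in> adjoin u W \<and> x \<in> V}"
    then obtain w c x where *: "y = (w + c *s u) + x" "w \<in> W" "x \<in> V" unfolding adjoin_def by auto
    then have "y = (w + x) + c *s u" "w + x \<in> V"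
      using V codim_subset[OF assms(1)] by (auto simp: algebra_simps intro: subspace_add)
    then show "y \<in> adjoin u V" unfolding adjoin_def by blast
  next
    fix y assume "y \<in> adjoin u V"
    then obtain x c where *: "y = x + c *s u" "x \<in> V" unfolding adjoin_def by auto
    moreover have "0 + c *s u \<in> adjoin u W"
      using assms subspace_0[of W] unfolding adjoin_def by blast
    ultimately have "y = (0 + c *s u) + id x" "0 + c *s u \<in> adjoin u W" by simp_all
    then show "y \<in> {a + id x | a x. a \<in> adjoin u W \<and> x \<in> V}" using * by blast
  qed
  ultimately show ?thesis by simp
qed

text \<open>By induction on the chain: the part of U below the last step is split by the induction
  hypothesis, and the last step is taken either inside U, if U contains a vector outside of the
  smaller space, or above U.\<close>

lemma codim_split:
  assumes "codim J n V" "subspace J" "subspace U" "J \<subseteq> U" "U \<subseteq> V"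
  obtains a b where "codim J a U" "codim U b V" "a + b = n"
proof -
  have "\<exists>a b. codim J a U \<and> codim U b V \<and> a + b = n"
    using assms(1,3-)
  proof (induction arbitrary: U rule: codim.induct)
    case codim_0
    then have "U = J" by blast
    then show ?case using codim.codim_0 by auto
  next
    case (codim_Suc n V v)
    have V: "subspace V" "J \<subseteq> V" using codim_Suc codim_subspace codim_subset assms by auto
    obtain a b where ab: "codim J a (U \<inter> V)" "codim (U \<inter> V) b V" "a + b = n"
      using codim_Suc.IH[of "U \<inter> V"] codim_Suc.prems V subspace_inter by auto
    show ?case
    proof (cases "U \<subseteq> V")
      case True
      then have "U \<inter> V = U" by blast
      with ab codim.codim_Suc[OF _ codim_Suc.hyps(2)] show ?thesis by (metis add_Suc_right)
    next
      case False
      then obtain u where u: "u \<in> U" "u \<notin> V" by blast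
      have ex: "adjoin u V = adjoin v V"
        using u codim_Suc.prems V by (intro adjoin_exchange) auto
      have U: "U = adjoin u (U \<inter> V)"
      proof
        show "adjoin u (U \<inter> V) \<subseteq> U" using u codim_Suc.prems by (intro adjoin_least) auto
        show "U \<subseteq> adjoin u (U \<inter> V)"
        proof
          fix x assume x: "x \<in> U"
          then obtain w c where w: "x = w + c *s u" "w \<in> V"
            using codim_Suc.prems ex unfolding adjoin_def by blast
          then have "w = x - c *s u" by simp
          then have "w \<in> U" using x u codim_Suc.prems by (auto intro: subspace_diff subspace_scale)
          then show "x \<in> adjoin u (U \<inter> V)" using w unfolding adjoin_def by blast
        qed
      qed
      have "codim J (Suc a) U" by (subst U) (rule codim.codim_Suc[OF ab(1)], use u in auto)
      moreover have "codim U b (adjoin v V)"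
        using codim_adjoin[OF ab(2) _ u(2)] codim_Suc.prems V subspace_inter ex U by metis
      ultimately show ?thesis using ab(3) by (metis add_Suc)
    qed
  qed
  then show ?thesis using that by blast
qed

lemma codim_self:
  assumes "codim U b U" "subspace U" shows "b = 0"
  using assms(1)
proof cases
  case (codim_Suc n V v)
  then have "U \<subseteq> V" "subspace V" using codim_subset codim_subspace assms by auto
  then show ?thesis using codim_Suc in_adjoin by blast
qed

text \<open>Cut the second chain at the last but one member V of the first. The part below V is known by
  induction, and the part from V to the space with one more vector can only be a single step.\<close>

lemma codim_unique:
  assumes "codim J n V" "codim J m V" "subspace J" shows "n = m"
  using assms
proof (induction arbitrary: m rule: codim.induct)
  case codim_0 then show ?case using codim_self by auto
next
  case (codim_Suc n V v)
  have V: "subspace V" "J \<subseteq> V" using codim_Suc codim_subspace codim_subset by auto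
  obtain a b where ab: "codim J a V" "codim V b (adjoin v V)" "a + b = m"
    using codim_split[OF codim_Suc.prems V] subset_adjoin by blast
  have "a = n" using codim_Suc.IH ab codim_Suc.prems by auto
  moreover have "b = 1" using ab(2)
  proof cases
    case codim_0 then show ?thesis using codim_Suc.hyps in_adjoin V by metis
  next
    case (codim_Suc k W w)
    show ?thesis
    proof (cases k)
      case 0 then show ?thesis using codim_Suc by simp
    next
      case (Suc l)
      have W: "subspace W" "W \<subseteq> adjoin v V" "w \<in> adjoin v V" "V \<subseteq> W"
        using codim_Suc V codim_subspace subset_adjoin in_adjoin codim_subset by (metis, metis, metis, metis)
      have "W \<noteq> V" using codim_Suc(3) codim_self V Suc by fastforce
      then obtain x where x: "x \<in> W" "x \<notin> V" using W by blast
      have "adjoin v V = adjoin x V" using adjoin_exchange[OF V(1) _ x(2)] x W by blast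
      also have "\<dots> \<subseteq> W" using x W by (intro adjoin_least)
      finally show ?thesis using codim_Suc W by blast
    qed
  qed
  ultimately show ?case using ab by simp
qed

end

section \<open>The local ring at a point and its ideals\<close>

lemma const3_simps:
  "const3 (c + d) = const3 c + const3 (d :: 'a::comm_monoid_add)"
  "const3 (a * b) = const3 a * const3 (b :: 'b::comm_semiring_0)"
  by (simp_all add: const3_def mult.commute)

definition fscale :: "'a::field \<Rightarrow> 'a poly3 fract \<Rightarrow> 'a poly3 fract" where
  "fscale c f = Fract (const3 c) 1 * f"

interpretation fscale: linear_space fscale
proof unfold_locales
  fix a b :: 'a and x y :: "'a poly3 fract"
  show "fscale a (x + y) = fscale a x + fscale a y" by (simp add: fscale_def distrib_left)
  have "Fract (const3 (a + b)) 1 = Fract (const3 a) 1 + Fract (const3 b) 1" by (simp add: const3_simps)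
  then show "fscale (a + b) x = fscale a x + fscale b x" unfolding fscale_def by (simp only: distrib_right)
  have "Fract (const3 (a * b)) 1 = Fract (const3 a) 1 * Fract (const3 b) 1" by (simp add: const3_simps)
  then show "fscale a (fscale b x) = fscale (a * b) x" unfolding fscale_def by (simp only: mult.assoc)
  have "Fract (const3 1) 1 = (1 :: 'a poly3 fract)" by (simp only: One_fract_def one_const3)
  then show "fscale 1 x = x" by (simp add: fscale_def)
qed

lemma proj_plane_rep:
  assumes "P \<in> proj_plane"
  obtains v where "v \<noteq> (0, 0, 0)" "v \<in> P" "\<And>w. w \<in> P \<Longrightarrow> \<exists>c. c \<noteq> 0 \<and> w = scale3 c v"
proof -
  obtain v where v: "v \<noteq> (0, 0, 0)" "P = proj_rel `` {v}"
    using assms by (auto simp: proj_plane_def quotient_def)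
  have "v = scale3 1 v" by (cases v) (simp add: scale3_def)
  then have "v \<in> P" using v by (auto simp: proj_rel_def)
  moreover have "\<exists>c. c \<noteq> 0 \<and> w = scale3 c v" if w: "w \<in> P" for w
  proof -
    obtain c where c: "w = scale3 c v" "w \<noteq> (0, 0, 0)" using w v by (auto simp: proj_rel_def)
    then have "c \<noteq> 0" by (cases v) (auto simp: scale3_def)
    with c show ?thesis by blast
  qed
  ultimately show ?thesis using that v by blast
qed

lemma nonvanishing_at_iff:
  assumes "P \<in> proj_plane" "v \<in> P" "homogeneous d T"
  shows "nonvanishing_at T P \<longleftrightarrow> eval3 T v \<noteq> 0"
proof -
  obtain v0 where v0: "\<And>w. w \<in> P \<Longrightarrow> \<exists>c. c \<noteq> 0 \<and> w = scale3 c v0" using proj_plane_rep assms by metis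
  have "eval3 T w = 0 \<longleftrightarrow> eval3 T v0 = 0" if "w \<in> P" for w
  proof -
    obtain c where "c \<noteq> 0" "w = scale3 c v0" using v0[OF \<open>w \<in> P\<close>] by blast
    then show ?thesis by (simp add: eval3_homogeneous_scale[OF assms(3)])
  qed
  then show ?thesis using assms(2) unfolding nonvanishing_at_def by blast
qed

lemma nonvanishing_at_mult: "nonvanishing_at (S * T) P \<longleftrightarrow> nonvanishing_at S P \<and> nonvanishing_at T P"
  by (auto simp: nonvanishing_at_def)

lemma nonvanishing_at_power: "nonvanishing_at T P \<Longrightarrow> nonvanishing_at (T ^ n) P"
  by (auto simp: nonvanishing_at_def)

lemma nonvanishing_at_1: "nonvanishing_at 1 P"
  by (auto simp: nonvanishing_at_def)

lemma nonvanishing_at_nonzero: "P \<in> proj_plane \<Longrightarrow> nonvanishing_at T P \<Longrightarrow> T \<noteq> 0"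
  using proj_plane_rep[of P] by (metis eval3_0 nonvanishing_at_def)

text \<open>A power of a coordinate that is not zero at P. Division by such a form turns forms of degree n
  into elements of the local ring.\<close>

lemma exists_nonvanishing_form:
  assumes "P \<in> proj_plane" obtains T where "homogeneous n T" "nonvanishing_at T P"
proof -
  obtain v where v: "v \<noteq> (0, 0, 0)" "v \<in> P" using proj_plane_rep assms by metis
  then have "\<exists>L::'a poly3. homogeneous 1 L \<and> eval3 L v \<noteq> 0"
  proof -
    obtain x y z where xyz: "v = (x, y, z)" by (cases v)
    have "homogeneous 1 (X3 :: 'a poly3)" "homogeneous 1 (Y3 :: 'a poly3)" "homogeneous 1 (Z3 :: 'a poly3)"
      using homogeneous_monom3[of 1 0 0 "1::'a"] homogeneous_monom3[of 0 1 0 "1::'a"]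
        homogeneous_monom3[of 0 0 1 "1::'a"] by auto
    moreover have "eval3 X3 v = x" "eval3 Y3 v = y" "eval3 Z3 v = z"
      unfolding xyz eval3_monom3 by simp_all
    ultimately show ?thesis using v xyz by (metis prod.inject)
  qed
  then obtain L :: "'a poly3" where L: "homogeneous 1 L" "eval3 L v \<noteq> 0" by blast
  then have "homogeneous n (L ^ n)" "nonvanishing_at (L ^ n) P"
    using homogeneous_power[of 1 L n] nonvanishing_at_iff[OF assms v(2)] by (auto intro: nonvanishing_at_power)
  then show ?thesis using that by blast
qed

abbreviation loc :: "('a::field \<times> 'a \<times> 'a) set \<Rightarrow> 'a poly3 fract set" where
  "loc P \<equiv> carrier (local_ring P)"

lemma loc_def: "loc P = {Fract S T | S T d. homogeneous d S \<and> homogeneous d T \<and> nonvanishing_at T P}"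
  by (simp add: local_ring_def)

lemma locI: "homogeneous d S \<Longrightarrow> homogeneous d T \<Longrightarrow> nonvanishing_at T P \<Longrightarrow> Fract S T \<in> loc P"
  by (auto simp: loc_def)

lemma locE:
  assumes "f \<in> loc P" "P \<in> proj_plane"
  obtains S T d where "f = Fract S T" "homogeneous d S" "homogeneous d T" "nonvanishing_at T P" "T \<noteq> 0"
  using assms nonvanishing_at_nonzero unfolding loc_def by blast

text \<open>The cofactors M and N are arbitrary polynomials here, which is what makes closure under addition
  easy: in a common denominator the cofactors add up without any control of their degrees.\<close>

lemma local_idealI:
  assumes "homogeneous m A" "homogeneous n B"
    and "homogeneous d S" "homogeneous d T" "nonvanishing_at T P" "S = M * A + N * B"
  shows "Fract S T \<in> local_ideal P A B"
proof -
  obtain M' N' where MN: "tdeg_in {e. e + m = d} M'" "tdeg_in {e. e + n = d} N'" "S = M' * A + N' * B"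
    using homogeneous_cofactors[OF assms(3,1,2,6)] by metis
  obtain e f where "homogeneous e M'" "homogeneous f N'"
    using MN tdeg_in_exists_homogeneous by metis
  with MN assms show ?thesis unfolding local_ideal_def by blast
qed

lemma local_idealE:
  assumes "f \<in> local_ideal P A B" "P \<in> proj_plane"
  obtains S T d M N where "f = Fract S T" "homogeneous d S" "homogeneous d T" "nonvanishing_at T P" "T \<noteq> 0"
    "S = M * A + N * B"
  using assms nonvanishing_at_nonzero unfolding local_ideal_def by blast

lemma loc_closed:
  assumes P: "P \<in> proj_plane" and fg: "f \<in> loc P" "g \<in> loc P"
  shows "f + g \<in> loc P" "f * g \<in> loc P" "- f \<in> loc P"
proof -
  obtain S T d where f: "f = Fract S T" "homogeneous d S" "homogeneous d T" "nonvanishing_at T P" "T \<noteq> 0"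
    using locE[OF fg(1) P] .
  obtain S' T' d' where g: "g = Fract S' T'" "homogeneous d' S'" "homogeneous d' T'" "nonvanishing_at T' P" "T' \<noteq> 0"
    using locE[OF fg(2) P] .
  have T: "homogeneous (d + d') (T * T')" "nonvanishing_at (T * T') P"
    using f g by (auto simp: nonvanishing_at_mult intro: homogeneous_mult)
  have "homogeneous (d + d') (S * T' + S' * T)"
    using homogeneous_mult[OF f(2) g(3)] homogeneous_mult[OF g(2) f(3)]
    by (auto intro: homogeneous_add simp: add.commute)
  then show "f + g \<in> loc P" using f g T by (auto intro: locI)
  show "f * g \<in> loc P" using f g T homogeneous_mult[OF f(2) g(2)] by (auto intro: locI)
  show "- f \<in> loc P" using f by (auto intro: locI homogeneous_minus)
qed

lemma const_in_loc: "Fract (const3 c) 1 \<in> loc P"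
  by (rule locI[OF homogeneous_const3 homogeneous_1 nonvanishing_at_1])

lemma one_in_loc: "1 \<in> loc P"
  using const_in_loc[of 1 P] by (simp add: One_fract_def flip: one_const3)

lemma subspace_loc: "P \<in> proj_plane \<Longrightarrow> fscale.subspace (loc P)"
  using const_in_loc[of 0 P]
  by (intro fscale.subspaceI)
     (auto simp: fscale_def const3_def Zero_fract_def intro: loc_closed const_in_loc[unfolded const3_def])

context
  fixes P :: "('a::field \<times> 'a \<times> 'a) set" and A B :: "'a poly3" and m n :: nat
  assumes P: "P \<in> proj_plane" and A: "homogeneous m A" and B: "homogeneous n B"
begin

lemma local_ideal_subset: "local_ideal P A B \<subseteq> loc P"
  unfolding local_ideal_def loc_def by blast

lemma local_ideal_add:
  assumes fg: "f \<in> local_ideal P A B" "g \<in> local_ideal P A B"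
  shows "f + g \<in> local_ideal P A B"
proof -
  obtain S T d M N where f: "f = Fract S T" "homogeneous d S" "homogeneous d T" "nonvanishing_at T P" "T \<noteq> 0"
     "S = M * A + N * B"
    using local_idealE[OF fg(1) P] .
  obtain S' T' d' M' N' where g: "g = Fract S' T'" "homogeneous d' S'" "homogeneous d' T'" "nonvanishing_at T' P" "T' \<noteq> 0"
     "S' = M' * A + N' * B"
    using local_idealE[OF fg(2) P] .
  have T: "homogeneous (d + d') (T * T')" "nonvanishing_at (T * T') P"
    using f g by (auto simp: nonvanishing_at_mult intro: homogeneous_mult)
  have "homogeneous (d + d') (S * T' + S' * T)"
    using homogeneous_mult[OF f(2) g(3)] homogeneous_mult[OF g(2) f(3)]
    by (auto intro: homogeneous_add simp: add.commute)
  moreover have "S * T' + S' * T = (M * T' + M' * T) * A + (N * T' + N' * T) * B"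
    by (simp add: f(6) g(6) algebra_simps)
  moreover have "f + g = Fract (S * T' + S' * T) (T * T')" using f g by simp
  ultimately show ?thesis using local_idealI[OF A B _ T] by metis
qed

lemma local_ideal_mult:
  assumes fg: "f \<in> local_ideal P A B" "g \<in> loc P"
  shows "g * f \<in> local_ideal P A B"
proof -
  obtain S T d M N where f: "f = Fract S T" "homogeneous d S" "homogeneous d T" "nonvanishing_at T P" "T \<noteq> 0"
     "S = M * A + N * B"
    using local_idealE[OF fg(1) P] .
  obtain S' T' d' where g: "g = Fract S' T'" "homogeneous d' S'" "homogeneous d' T'" "nonvanishing_at T' P" "T' \<noteq> 0"
    using locE[OF fg(2) P] .
  have T: "homogeneous (d' + d) (T' * T)" "nonvanishing_at (T' * T) P" "homogeneous (d' + d) (S' * S)"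
    using f g by (auto simp: nonvanishing_at_mult intro: homogeneous_mult)
  moreover have "S' * S = (S' * M) * A + (S' * N) * B" by (simp add: f(6) algebra_simps)
  moreover have "g * f = Fract (S' * S) (T' * T)" using f g by simp
  ultimately show ?thesis using local_idealI[OF A B] by metis
qed

lemma zero_in_local_ideal: "0 \<in> local_ideal P A B"
  using local_idealI[OF A B, of 0 0 1 P 0 0] by (simp add: nonvanishing_at_1 Zero_fract_def)

lemma subspace_local_ideal: "fscale.subspace (local_ideal P A B)"
  by (intro fscale.subspaceI)
     (auto simp: fscale_def intro: zero_in_local_ideal local_ideal_add local_ideal_mult const_in_loc)

lemma local_ideal_eq_loc_iff: "local_ideal P A B = loc P \<longleftrightarrow> 1 \<in> local_ideal P A B"
  using local_ideal_mult[of 1] local_ideal_subset one_in_loc by fastforce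

lemma local_ideal_commute: "local_ideal P A B = local_ideal P B A"
  unfolding local_ideal_def by (metis (no_types, opaque_lifting) add.commute)

text \<open>A form that does not vanish at P generates the unit ideal of the local ring, because 1 = B/B.\<close>

lemma codim_local_ideal_0:
  assumes "nonvanishing_at B P" shows "fscale.codim (local_ideal P A B) 0 (loc P)"
proof -
  have "Fract B B = 1"
    using nonvanishing_at_nonzero[OF P assms] by (simp add: One_fract_def eq_fract)
  moreover have "Fract B B \<in> local_ideal P A B"
    using local_idealI[OF A B B B assms, of 0 1] by simp
  ultimately show ?thesis by (metis fscale.codim_0_iff local_ideal_eq_loc_iff)
qed

lemma local_ideal_reduce:
  assumes "homogeneous n (B + C * A)"
  shows "local_ideal P A (B + C * A) = local_ideal P A B"
proof (intro equalityI subsetI)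
  fix f assume "f \<in> local_ideal P A (B + C * A)"
  then obtain S T d M N where f: "f = Fract S T" "homogeneous d S" "homogeneous d T" "nonvanishing_at T P"
     "S = M * A + N * (B + C * A)"
    using P by (elim local_idealE)
  moreover have "S = (M + N * C) * A + N * B" by (simp add: f(5) algebra_simps)
  ultimately show "f \<in> local_ideal P A B" using local_idealI[OF A B] by blast
next
  fix f assume "f \<in> local_ideal P A B"
  then obtain S T d M N where f: "f = Fract S T" "homogeneous d S" "homogeneous d T" "nonvanishing_at T P"
     "S = M * A + N * B"
    using P by (elim local_idealE)
  moreover have "S = (M - N * C) * A + N * (B + C * A)" by (simp add: f(5) algebra_simps)
  ultimately show "f \<in> local_ideal P A (B + C * A)" using local_idealI[OF A assms] by blast
qed

text \<open>The exact sequence 0 \<rightarrow> R/(A, C) \<rightarrow> R/(A, BC) \<rightarrow> R/(A, B) \<rightarrow> 0. Its first map is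
  multiplication by \<beta> = B/U, where U is any form of the degree of B that does not vanish at P; it
  stands in for multiplication by B, which is not an element of the local ring.\<close>

lemma local_ideal_mult_exact:
  assumes C: "homogeneous l C" and cop: "\<And>M. B dvd M * A \<Longrightarrow> B dvd M" and "B \<noteq> 0"
  obtains \<beta> where
    "\<And>g. g \<in> loc P \<Longrightarrow> \<beta> * g \<in> local_ideal P A (B * C) \<longleftrightarrow> g \<in> local_ideal P A C"
    "{f + \<beta> * g | f g. f \<in> local_ideal P A (B * C) \<and> g \<in> loc P} = local_ideal P A B"
proof -
  have BC: "homogeneous (n + l) (B * C)" using B C by (rule homogeneous_mult)
  obtain U where U: "homogeneous n U" "nonvanishing_at U P" using exists_nonvanishing_form[OF P] .
  have U0: "U \<noteq> 0" using U P nonvanishing_at_nonzero by blast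
  define \<beta> where "\<beta> = Fract B U"
  show ?thesis
  proof (rule that[of \<beta>])
    fix g assume "g \<in> loc P"
    then obtain S T d where g: "g = Fract S T" "homogeneous d S" "homogeneous d T" "nonvanishing_at T P" "T \<noteq> 0"
      using locE P by metis
    have bg: "\<beta> * g = Fract (B * S) (U * T)" using g by (simp add: \<beta>_def)
    show "\<beta> * g \<in> local_ideal P A (B * C) \<longleftrightarrow> g \<in> local_ideal P A C"
    proof
      assume "g \<in> local_ideal P A C"
      then obtain S T d M N where g: "g = Fract S T" "homogeneous d S" "homogeneous d T" "nonvanishing_at T P"
         "S = M * A + N * C"
        using P by (elim local_idealE)
      have bg: "\<beta> * g = Fract (B * S) (U * T)" using g by (simp add: \<beta>_def)
      have *: "homogeneous (n + d) (B * S)" "homogeneous (n + d) (U * T)" "nonvanishing_at (U * T) P"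
        using B U g by (auto simp: nonvanishing_at_mult intro: homogeneous_mult)
      have "B * S = (B * M) * A + N * (B * C)" by (simp add: g(5) algebra_simps)
      from local_idealI[OF A BC * this] show "\<beta> * g \<in> local_ideal P A (B * C)" unfolding bg .
    next
      assume "\<beta> * g \<in> local_ideal P A (B * C)"
      then obtain S' T' d' M N where h: "\<beta> * g = Fract S' T'" "homogeneous d' S'" "homogeneous d' T'" "nonvanishing_at T' P"
         "T' \<noteq> 0" "S' = M * A + N * (B * C)"
        using P by (elim local_idealE)
      have "B * S * T' = S' * (U * T)"
        using bg h(1,5) g(5) U0 by (simp add: eq_fract)
      then have eq: "B * (S * T' - U * T * N * C) = (U * T * M) * A"
        unfolding h(6) by (simp add: algebra_simps)
      then have "B dvd (U * T * M) * A" by (metis dvd_triv_left)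
      \<comment> \<open>B divides the cofactor of A, so it can be cancelled from the whole equation\<close>
      then obtain M' where M': "U * T * M = B * M'" using cop by blast
      have "B * (S * T' - U * T * N * C) = B * (M' * A)" unfolding eq M' by (simp only: mult.assoc)
      then have "S * T' - U * T * N * C = M' * A" using \<open>B \<noteq> 0\<close> by (simp only: mult_cancel_left) simp
      then have eq': "S * T' = M' * A + (U * T * N) * C" by (simp only: diff_eq_eq)
      have "g = Fract (S * T') (T * T')" using g(1) g(5) h(5) by (simp add: eq_fract)
      moreover have *: "homogeneous (d + d') (S * T')" "homogeneous (d + d') (T * T')" "nonvanishing_at (T * T') P"
        using g h by (auto simp: nonvanishing_at_mult intro: homogeneous_mult)
      ultimately show "g \<in> local_ideal P A C" using local_idealI[OF A C * eq'] by simp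
    qed
  next
    show "{f + \<beta> * g | f g. f \<in> local_ideal P A (B * C) \<and> g \<in> loc P} = local_ideal P A B"
    proof (intro equalityI subsetI)
      fix h assume "h \<in> {f + \<beta> * g | f g. f \<in> local_ideal P A (B * C) \<and> g \<in> loc P}"
      then obtain f g where h: "h = f + \<beta> * g" and fg: "f \<in> local_ideal P A (B * C)" "g \<in> loc P"
        by blast
      obtain S T d M N where f: "f = Fract S T" "homogeneous d S" "homogeneous d T" "nonvanishing_at T P"
         "S = M * A + N * (B * C)"
        using P fg(1) by (elim local_idealE)
      have "S = M * A + (N * C) * B" by (simp add: f(5) algebra_simps)
      from local_idealI[OF A B f(2-4) this] have "f \<in> local_ideal P A B" unfolding f(1) .
      moreover have "\<beta> \<in> local_ideal P A B"
        unfolding \<beta>_def using B U by (intro local_idealI[OF A B, of _ _ _ _ 0 1]) auto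
      ultimately show "h \<in> local_ideal P A B"
        unfolding h mult.commute[of \<beta> g] by (intro local_ideal_add local_ideal_mult fg)
    next
      fix h assume "h \<in> local_ideal P A B"
      then obtain S T d M N where h: "h = Fract S T" "homogeneous d S" "homogeneous d T" "nonvanishing_at T P" "T \<noteq> 0"
         "S = M * A + N * B"
        using P by (elim local_idealE)
      obtain M' N' where MN: "tdeg_in {e. e + m = d} M'" "tdeg_in {e. e + n = d} N'" "S = M' * A + N' * B"
        using homogeneous_cofactors[OF h(2) A B h(6)] by metis
      \<comment> \<open>N' is zero or a form of degree d - n, so N' U / T lies in the local ring\<close>
      have d: "homogeneous d (N' * U)"
        using tdeg_in_eq_homogeneous[OF MN(2)] homogeneous_mult[OF _ U(1), of "d - n" N']
        by (cases "n \<le> d") simp_all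
      have "homogeneous d (N' * B)"
        using tdeg_in_eq_homogeneous[OF MN(2)] homogeneous_mult[OF _ B, of "d - n" N']
        by (cases "n \<le> d") simp_all
      from homogeneous_diff[OF h(2) this] have "homogeneous d (M' * A)" unfolding MN(3) by simp
      then have "Fract (M' * A) T \<in> local_ideal P A (B * C)"
        using h(3,4) by (intro local_idealI[OF A BC, of _ _ _ _ M' 0]) simp_all
      moreover have "Fract (N' * U) T \<in> loc P" using d h(3,4) by (rule locI)
      moreover have "h = Fract (M' * A) T + \<beta> * Fract (N' * U) T"
      proof -
        have "\<beta> * Fract (N' * U) T = Fract (N' * B) T"
          using U0 h(5) by (simp add: \<beta>_def eq_fract algebra_simps)
        moreover have "Fract (M' * A) T + Fract (N' * B) T = Fract S T"
          using h(5) unfolding MN(3) by (simp add: eq_fract algebra_simps)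
        ultimately show ?thesis by (simp only: h(1))
      qed
      ultimately show "h \<in> {f + \<beta> * g | f g. f \<in> local_ideal P A (B * C) \<and> g \<in> loc P}" by blast
    qed
  qed
qed

end

text \<open>The chain for (A, C) is carried along the first map of the exact sequence.\<close>

lemma codim_local_ideal_mult:
  fixes A B C :: "'a::field poly3"
  assumes P: "P \<in> proj_plane" and hom: "homogeneous m A" "homogeneous n B" "homogeneous l C"
    and cop: "\<And>M. B dvd M * A \<Longrightarrow> B dvd M" and "B \<noteq> 0"
    and C: "fscale.codim (local_ideal P A C) c (loc P)"
  shows "fscale.codim (local_ideal P A (B * C)) c (local_ideal P A B)"
proof -
  show ?thesis
  proof (rule local_ideal_mult_exact[OF P hom cop \<open>B \<noteq> 0\<close>])
    fix \<beta>
    assume \<beta>: "\<And>g. g \<in> loc P \<Longrightarrow> \<beta> * g \<in> local_ideal P A (B * C) \<longleftrightarrow> g \<in> local_ideal P A C"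
      "{f + \<beta> * g | f g. f \<in> local_ideal P A (B * C) \<and> g \<in> loc P} = local_ideal P A B"
    have "fscale.codim (local_ideal P A (B * C)) c {f + \<beta> * g | f g. f \<in> local_ideal P A (B * C) \<and> g \<in> loc P}"
    proof (rule fscale.codim_image[OF C])
      show "fscale.subspace (local_ideal P A (B * C))"
        by (rule subspace_local_ideal[OF P hom(1) homogeneous_mult[OF hom(2,3)]])
      show "fscale.subspace (local_ideal P A C)"
        using P hom by (intro subspace_local_ideal)
    qed (use \<beta>(1) in \<open>simp_all add: distrib_left mult.left_commute fscale_def\<close>)
    then show ?thesis using \<beta>(2) by simp
  qed
qed

section \<open>Intersection multiplicity as the length of a chain\<close>

lemma local_ring_is_cring: "P \<in> proj_plane \<Longrightarrow> cring (local_ring P)"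
proof -
  assume P: "P \<in> proj_plane"
  interpret F: cring "ring_of_type_algebra :: 'a poly3 fract ring" by (rule cring_from_type_algebra)
  have minus: "\<ominus>\<^bsub>ring_of_type_algebra\<^esub> f = - f" for f :: "'a poly3 fract"
    by (rule F.minus_equality) (simp_all add: ring_of_type_algebra_def)
  have "subcring (loc P) (ring_of_type_algebra :: 'a poly3 fract ring)"
    by (intro F.subcringI' F.subringI; (unfold minus)?)
       (auto simp: ring_of_type_algebra_def intro: loc_closed[OF P] one_in_loc)
  from F.subcring_iff[THEN iffD1, OF _ this]
  show ?thesis by (simp add: local_ring_def ring_of_type_algebra_def)
qed

lemma local_ring_simps:
  "\<zero>\<^bsub>local_ring P\<^esub> = 0" "\<one>\<^bsub>local_ring P\<^esub> = 1"
  "f \<oplus>\<^bsub>local_ring P\<^esub> g = f + g" "f \<otimes>\<^bsub>local_ring P\<^esub> g = f * g"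
  by (simp_all add: local_ring_def ring_of_type_algebra_def)

text \<open>Chains in the local ring that start at the ideal correspond to chains in the quotient ring that
  start at zero. Both directions matter: a chain in the ring gives the dimension of the quotient,
  and because a chain in the quotient lifts to the ring, the uniqueness of lengths there makes the
  dimension unique. The argument includes the zero quotient, in which the image of the ground
  field is not a field.\<close>

lemma intersection_mult_eqI:
  fixes A B :: "'a::field poly3"
  assumes P: "P \<in> proj_plane" and A: "homogeneous m A" and B: "homogeneous n B"
    and n: "fscale.codim (local_ideal P A B) N (loc P)"
  shows "intersection_mult P A B = enat N"
proof -
  let ?R = "local_ring P" and ?J = "local_ideal P A B"
  define Q where "Q = ?R Quot ?J"
  define h where "h = (\<lambda>f. ?J +>\<^bsub>?R\<^esub> f)"
  define K where "K = quotient_scalars P A B"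
  interpret R: cring ?R using local_ring_is_cring[OF P] .
  interpret J: ideal ?J ?R
  proof (intro idealI R.ring_axioms)
    show "subgroup ?J (add_monoid ?R)"
    proof (intro R.add.subgroupI)
      show "?J \<subseteq> carrier ?R" using local_ideal_subset[OF P A B] by simp
      show "?J \<noteq> {}" using zero_in_local_ideal[OF P A B] by blast
      show "\<ominus>\<^bsub>?R\<^esub> a \<in> ?J" if a: "a \<in> ?J" for a
      proof -
        have a': "a \<in> loc P" using a local_ideal_subset[OF P A B] by blast
        have "\<ominus>\<^bsub>?R\<^esub> a = - a"
          using a' loc_closed(3)[OF P a' a'] by (intro R.minus_equality) (simp_all add: local_ring_simps)
        also have "\<dots> = (- 1) * a" by simp
        also have "\<dots> \<in> ?J"
          using local_ideal_mult[OF P A B a] loc_closed(3)[OF P one_in_loc one_in_loc] by blast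
        finally show ?thesis .
      qed
      show "a \<oplus>\<^bsub>?R\<^esub> b \<in> ?J" if "a \<in> ?J" "b \<in> ?J" for a b
        using that local_ideal_add[OF P A B] by (simp add: local_ring_simps)
    qed
  qed (use local_ideal_mult[OF P A B] in \<open>auto simp: local_ring_simps mult.commute\<close>)
  interpret Q: ring Q unfolding Q_def by (rule J.quotient_is_ring)
  have hom: "h \<in> ring_hom ?R Q" unfolding h_def Q_def by (rule J.rcos_ring_hom)
  have hadd: "h (f + g) = h f \<oplus>\<^bsub>Q\<^esub> h g" if "f \<in> loc P" "g \<in> loc P" for f g
    using ring_hom_add[OF hom that] by (simp add: local_ring_simps)
  have hscale: "h (fscale c f) = h (Fract (const3 c) 1) \<otimes>\<^bsub>Q\<^esub> h f" if "f \<in> loc P" for f c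
    using ring_hom_mult[OF hom const_in_loc that] by (simp add: local_ring_simps fscale_def)
  have carrier: "carrier Q = h ` loc P"
    by (auto simp: Q_def h_def FactRing_def A_RCOSETS_def')
  have K: "K = range (\<lambda>c. h (Fract (const3 c) 1))"
    by (simp add: K_def h_def quotient_scalars_def)
  have h_coset: "h f = {j + f | j. j \<in> ?J}" for f
    by (auto simp: h_def a_r_coset_def' local_ring_simps)
  have h_eq: "h f = h g \<longleftrightarrow> f - g \<in> ?J" for f g
  proof
    assume "h f = h g"
    moreover have "f \<in> h f" using zero_in_local_ideal[OF P A B] unfolding h_coset by (metis (mono_tags, lifting) add_0 mem_Collect_eq)
    ultimately obtain j where "f = j + g" "j \<in> ?J" unfolding h_coset by blast
    then show "f - g \<in> ?J" by simp
  next
    assume fg: "f - g \<in> ?J"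
    have "h f \<subseteq> h g" if "f - g \<in> ?J" for f g
    proof
      fix x assume "x \<in> h f"
      then obtain j where "x = j + f" "j \<in> ?J" unfolding h_coset by blast
      then have "x = (j + (f - g)) + g" "j + (f - g) \<in> ?J"
        using that local_ideal_add[OF P A B] by simp_all
      then show "x \<in> h g" unfolding h_coset by blast
    qed
    moreover have "g - f \<in> ?J"
      using fg fscale.subspace_neg[OF subspace_local_ideal[OF P A B] fg] by simp
    ultimately show "h f = h g" using fg by blast
  qed
  have zero: "\<zero>\<^bsub>Q\<^esub> = h 0" using ring_hom_zero[OF hom R.ring_axioms Q.ring_axioms] by (simp add: local_ring_simps)
  have sub: "fscale.subspace ?J" by (rule subspace_local_ideal[OF P A B])
  have line: "h ` fscale.adjoin v V = Q.line_extension K (h v) (h ` V)" if "V \<subseteq> loc P" "v \<in> loc P" for v V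
  proof -
    have *: "h (u + fscale c v) = h (Fract (const3 c) 1) \<otimes>\<^bsub>Q\<^esub> h v \<oplus>\<^bsub>Q\<^esub> h u" if "u \<in> V" for u c
    proof -
      have uv: "u \<in> loc P" "fscale c v \<in> loc P"
        using that \<open>V \<subseteq> loc P\<close> \<open>v \<in> loc P\<close> subspace_loc[OF P] fscale.subspace_scale by blast+
      have "h (u + fscale c v) = h (fscale c v + u)" by (simp only: add.commute)
      then show ?thesis using hadd[OF uv(2,1)] hscale[OF \<open>v \<in> loc P\<close>] by simp
    qed
    show ?thesis
    proof (intro equalityI subsetI)
      fix x assume "x \<in> h ` fscale.adjoin v V"
      then obtain u c where "x = h (u + fscale c v)" "u \<in> V" unfolding fscale.adjoin_def by blast
      with * K show "x \<in> Q.line_extension K (h v) (h ` V)"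
        unfolding Q.line_extension_mem_iff by blast
    next
      fix x assume "x \<in> Q.line_extension K (h v) (h ` V)"
      then obtain c u where "x = h (Fract (const3 c) 1) \<otimes>\<^bsub>Q\<^esub> h v \<oplus>\<^bsub>Q\<^esub> h u" "u \<in> V"
        unfolding Q.line_extension_mem_iff K by blast
      with * have "x = h (u + fscale c v)" by metis
      with \<open>u \<in> V\<close> show "x \<in> h ` fscale.adjoin v V" unfolding fscale.adjoin_def by blast
    qed
  qed
  have dim: "Q.dimension k K (h ` V)" if "fscale.codim ?J k V" "V \<subseteq> loc P" for k V
    using that
  proof (induction rule: fscale.codim.induct)
    case codim_0
    have "h ` ?J = {\<zero>\<^bsub>Q\<^esub>}"
    proof -
      have "h j = h 0" if "j \<in> ?J" for j using that h_eq[of j 0] by simp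
      then show ?thesis using zero_in_local_ideal[OF P A B] unfolding zero by blast
    qed
    then show ?case by simp
  next
    case (codim_Suc k V v)
    have V: "fscale.subspace V" "?J \<subseteq> V"
      using codim_Suc fscale.codim_subspace[OF _ sub] fscale.codim_subset by blast+
    have vV: "V \<subseteq> loc P" "v \<in> loc P"
      using codim_Suc.prems fscale.subset_adjoin[of V v] fscale.in_adjoin[OF V(1)] by blast+
    have "h v \<notin> h ` V"
    proof
      assume "h v \<in> h ` V"
      then obtain u where u: "u \<in> V" "v - u \<in> V" using h_eq V by blast
      then have "v \<in> V" using fscale.subspace_add[OF V(1), of "v - u" u] by simp
      then show False using codim_Suc by blast
    qed
    moreover have "h v \<in> carrier Q" using vV carrier by blast
    ultimately show ?case unfolding line[OF vV] using codim_Suc vV by (blast intro: Q.Suc_dim)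
  qed
  have codim: "\<exists>V. E = h ` V \<and> V \<subseteq> loc P \<and> fscale.codim ?J k V" if "Q.dimension k K' E" "K' = K" for k K' E
    using that
  proof (induction rule: Q.dimension.induct)
    case (zero_dim K')
    have "h ` ?J = {\<zero>\<^bsub>Q\<^esub>}"
    proof -
      have "h j = h 0" if "j \<in> ?J" for j using that h_eq[of j 0] by simp
      then show ?thesis using zero_in_local_ideal[OF P A B] unfolding zero by blast
    qed
    then show ?case using fscale.codim_0 local_ideal_subset[OF P A B] by metis
  next
    case (Suc_dim v E n K')
    then obtain V where V: "E = h ` V" "V \<subseteq> loc P" "fscale.codim ?J n V" by blast
    obtain w where w: "v = h w" "w \<in> loc P" using Suc_dim carrier by blast
    have "w \<notin> V" using Suc_dim w V by blast
    then have "fscale.codim ?J (Suc n) (fscale.adjoin w V)" by (rule fscale.codim_Suc[OF V(3)])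
    moreover have "fscale.adjoin w V \<subseteq> loc P"
      using V w by (intro fscale.adjoin_least subspace_loc P)
    ultimately show ?case using line[OF V(2) w(2)] V w Suc_dim.prems by metis
  qed
  have N: "Q.dimension N K (carrier Q)" using dim[OF n] carrier by simp
  have "k = N" if k: "Q.dimension k K (carrier Q)" for k
  proof -
    obtain V where V: "h ` loc P = h ` V" "V \<subseteq> loc P" "fscale.codim ?J k V"
      using codim[OF k] carrier by auto
    have JV: "?J \<subseteq> V" "fscale.subspace V"
      using fscale.codim_subset[OF V(3)] fscale.codim_subspace[OF V(3) sub] by simp_all
    have "loc P \<subseteq> V"
    proof
      fix x assume "x \<in> loc P"
      then have "h x \<in> h ` loc P" by (rule imageI)
      then have "h x \<in> h ` V" by (simp only: V(1))
      then obtain u where u: "h x = h u" "u \<in> V" by (rule imageE)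
      have "x - u \<in> V" using u(1) JV(1) by (simp only: h_eq) (rule subsetD)
      from fscale.subspace_add[OF JV(2) this u(2)] show "x \<in> V" by simp
    qed
    with V(2) have "V = loc P" by (rule subset_antisym)
    then show "k = N" using fscale.codim_unique[OF _ n sub] V(3) by simp
  qed
  then have "Q.dim K (carrier Q) = N" unfolding Q.dim_def using N by blast
  moreover have "intersection_mult P A B =
      (if Q.finite_dimension K (carrier Q) then enat (Q.dim K (carrier Q)) else \<infinity>)"
    unfolding intersection_mult_def Let_def local_quotient_def Q_def K_def ..
  ultimately show ?thesis using Q.finite_dimensionI[OF N] by simp
qed

section \<open>Intersection numbers of two curves\<close>

text \<open>A relation between the curves and the number N, so that it also expresses that all multiplicities
  are finite and almost all of them vanish.\<close>

definition total_intersection :: "'a::field poly3 \<Rightarrow> 'a poly3 \<Rightarrow> nat \<Rightarrow> bool" where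
  "total_intersection A B N \<longleftrightarrow>
     (\<exists>\<iota>. (\<forall>P\<in>proj_plane. fscale.codim (local_ideal P A B) (\<iota> P) (loc P)) \<and>
          finite {P \<in> proj_plane. \<iota> P \<noteq> 0} \<and> (\<Sum>P | P \<in> proj_plane \<and> \<iota> P \<noteq> 0. \<iota> P) = N)"

lemma total_intersection_commute:
  assumes "homogeneous m A" "homogeneous n B" "total_intersection A B N"
  shows "total_intersection B A N"
proof -
  have "local_ideal P A B = local_ideal P B A" if "P \<in> proj_plane" for P
    using local_ideal_commute[OF that assms(1,2)] .
  then show ?thesis using assms(3) unfolding total_intersection_def by fastforce
qed

lemma total_intersection_reduce:
  assumes "homogeneous m A" "homogeneous n B" "homogeneous n (B + C * A)"
  shows "total_intersection A (B + C * A) N \<longleftrightarrow> total_intersection A B N"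
proof -
  have "local_ideal P A (B + C * A) = local_ideal P A B" if "P \<in> proj_plane" for P
    using local_ideal_reduce[OF that assms] .
  then show ?thesis unfolding total_intersection_def by (metis (no_types, lifting))
qed

lemma sum_over_support:
  fixes f :: "'b \<Rightarrow> nat"
  assumes "finite S" "{x \<in> U. f x \<noteq> 0} \<subseteq> S" "S \<subseteq> U"
  shows "(\<Sum>x | x \<in> U \<and> f x \<noteq> 0. f x) = sum f S"
  by (rule sum.mono_neutral_left) (use assms in auto)

lemma total_intersection_mult:
  assumes hom: "homogeneous m A" "homogeneous n B" "homogeneous l C"
    and cop: "\<And>M. B dvd M * A \<Longrightarrow> B dvd M" and "B \<noteq> 0"
    and "total_intersection A B N" "total_intersection A C N'"
  shows "total_intersection A (B * C) (N + N')"
proof -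
  obtain f where f: "\<And>P. P \<in> proj_plane \<Longrightarrow> fscale.codim (local_ideal P A B) (f P) (loc P)"
    "finite {P \<in> proj_plane. f P \<noteq> 0}" "(\<Sum>P | P \<in> proj_plane \<and> f P \<noteq> 0. f P) = N"
    using assms(6) unfolding total_intersection_def by blast
  obtain g where g: "\<And>P. P \<in> proj_plane \<Longrightarrow> fscale.codim (local_ideal P A C) (g P) (loc P)"
    "finite {P \<in> proj_plane. g P \<noteq> 0}" "(\<Sum>P | P \<in> proj_plane \<and> g P \<noteq> 0. g P) = N'"
    using assms(7) unfolding total_intersection_def by blast
  define S where "S = {P \<in> proj_plane. f P \<noteq> 0} \<union> {P \<in> proj_plane. g P \<noteq> 0}"
  have S: "finite S" "S \<subseteq> proj_plane" using f g by (auto simp: S_def)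
  have "fscale.codim (local_ideal P A (B * C)) (f P + g P) (loc P)" if P: "P \<in> proj_plane" for P
    using fscale.codim_trans[OF codim_local_ideal_mult[OF P hom cop \<open>B \<noteq> 0\<close> g(1)[OF P]] f(1)[OF P]]
    by (simp add: add.commute)
  moreover have "finite {P \<in> proj_plane. f P + g P \<noteq> 0}"
    by (rule finite_subset[OF _ S(1)]) (auto simp: S_def)
  moreover have "(\<Sum>P | P \<in> proj_plane \<and> f P + g P \<noteq> 0. f P + g P) = sum (\<lambda>P. f P + g P) S"
    by (rule sum_over_support[OF S(1) _ S(2)]) (auto simp: S_def)
  moreover have "sum f S = N" "sum g S = N'"
    using f g sum_over_support[OF S(1) _ S(2), of f] sum_over_support[OF S(1) _ S(2), of g]
    by (auto simp: S_def)
  ultimately show ?thesis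
    unfolding total_intersection_def by (intro exI[of _ "\<lambda>P. f P + g P"]) (simp add: sum.distrib)
qed

text \<open>The additivity of intersection numbers, read backwards: if (A, BC) has finite codimension at every
  point, then so has the larger ideal (A, B), and the chain from (A, BC) to the local ring
  can be cut there.\<close>

lemma total_intersection_cancel:
  assumes hom: "homogeneous m A" "homogeneous n B" "homogeneous l C"
    and cop: "\<And>M. B dvd M * A \<Longrightarrow> B dvd M" and "B \<noteq> 0"
    and "total_intersection A (B * C) (N + N')" "total_intersection A C N'"
  shows "total_intersection A B N"
proof -
  obtain f where f: "\<And>P. P \<in> proj_plane \<Longrightarrow> fscale.codim (local_ideal P A (B * C)) (f P) (loc P)"
    "finite {P \<in> proj_plane. f P \<noteq> 0}" "(\<Sum>P | P \<in> proj_plane \<and> f P \<noteq> 0. f P) = N + N'"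
    using assms(6) unfolding total_intersection_def by blast
  obtain g where g: "\<And>P. P \<in> proj_plane \<Longrightarrow> fscale.codim (local_ideal P A C) (g P) (loc P)"
    "finite {P \<in> proj_plane. g P \<noteq> 0}" "(\<Sum>P | P \<in> proj_plane \<and> g P \<noteq> 0. g P) = N'"
    using assms(7) unfolding total_intersection_def by blast
  have BC: "homogeneous (n + l) (B * C)" using hom homogeneous_mult by blast
  have split: "\<exists>b. fscale.codim (local_ideal P A B) b (loc P) \<and> g P + b = f P" if P: "P \<in> proj_plane" for P
  proof -
    have sub: "fscale.subspace (local_ideal P A (B * C))" "fscale.subspace (local_ideal P A B)"
      using subspace_local_ideal[OF P hom(1) BC] subspace_local_ideal[OF P hom(1,2)] .
    have g': "fscale.codim (local_ideal P A (B * C)) (g P) (local_ideal P A B)"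
      by (rule codim_local_ideal_mult[OF P hom cop \<open>B \<noteq> 0\<close> g(1)[OF P]])
    obtain a b where ab: "fscale.codim (local_ideal P A (B * C)) a (local_ideal P A B)"
      "fscale.codim (local_ideal P A B) b (loc P)" "a + b = f P"
      using fscale.codim_split[OF f(1)[OF P] sub fscale.codim_subset[OF g'] local_ideal_subset[OF P hom(1,2)]] .
    have "a = g P" using fscale.codim_unique[OF ab(1) g' sub(1)] .
    with ab show ?thesis by blast
  qed
  then obtain h where h: "\<And>P. P \<in> proj_plane \<Longrightarrow> fscale.codim (local_ideal P A B) (h P) (loc P)"
    "\<And>P. P \<in> proj_plane \<Longrightarrow> f P = g P + h P"
    by metis
  define S where "S = {P \<in> proj_plane. f P \<noteq> 0}"
  have S: "finite S" "S \<subseteq> proj_plane" using f by (auto simp: S_def)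
  have "finite {P \<in> proj_plane. h P \<noteq> 0}"
    by (rule finite_subset[OF _ S(1)]) (auto simp: S_def h)
  moreover have "(\<Sum>P | P \<in> proj_plane \<and> h P \<noteq> 0. h P) = sum h S"
    by (rule sum_over_support[OF S(1) _ S(2)]) (auto simp: S_def h)
  moreover have "sum g S = N'"
  proof -
    have "{P \<in> proj_plane. g P \<noteq> 0} \<subseteq> S" by (auto simp: S_def h)
    from sum_over_support[OF S(1) this S(2)] g(3) show ?thesis by (simp only:)
  qed
  moreover have "sum f S = N + N'" using f by (simp add: S_def)
  moreover have "sum f S = sum g S + sum h S"
    unfolding sum.distrib[symmetric] by (rule sum.cong) (use S h in auto)
  ultimately show ?thesis
    unfolding total_intersection_def using h by (intro exI[of _ h]) simp
qed

lemma total_intersection_const: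
  assumes "homogeneous m A" "c \<noteq> 0" shows "total_intersection A (const3 c) 0"
  unfolding total_intersection_def
  by (rule exI[of _ "\<lambda>_. 0"])
     (auto simp: nonvanishing_at_def assms(2) intro!: codim_local_ideal_0[OF _ assms(1) homogeneous_const3])

lemma homogeneous_0_const:
  assumes "homogeneous 0 p" shows "p = const3 (coeff3 p 0 0 0)"
  by (rule poly3_eqI) (use assms in \<open>auto simp: const3_monom3 coeff3_monom3 homogeneous_def\<close>)

lemma is_unit_const3: "c \<noteq> 0 \<Longrightarrow> const3 (c :: 'a::field) dvd 1"
  by (rule dvdI[of _ _ "const3 (inverse c)"]) (simp add: one_const3 flip: const3_simps)

lemma is_unit_poly3: 
  fixes p :: "'a::field poly3"
  assumes "p dvd 1" obtains c where "c \<noteq> 0" "p = const3 c"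
  using assms by (auto simp: is_unit_poly_iff const3_def dvd_field_iff)

section \<open>Forms on a line\<close>

lemma homogeneous_XYZ: "homogeneous (Suc 0) X3" "homogeneous (Suc 0) Y3" "homogeneous (Suc 0) Z3"
  using homogeneous_monom3[of 1 0 0 1] homogeneous_monom3[of 0 1 0 1] homogeneous_monom3[of 0 0 1 1]
  by (simp_all only: add_0_left add_0_right One_nat_def)

lemma eval3_XYZ [simp]:
  "eval3 X3 (x, y, z) = x" "eval3 Y3 (x, y, z) = y" "eval3 Z3 (x, y, z) = (z :: 'a::comm_semiring_1)"
  unfolding eval3_monom3 by simp_all

definition pair_ideal :: "'a::comm_ring_1 poly3 \<Rightarrow> 'a poly3 \<Rightarrow> 'a poly3 set" where
  "pair_ideal L L' = {M * L + N * L' | M N. True}"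

lemma pair_ideal_closed:
  "0 \<in> pair_ideal L L'" "L \<in> pair_ideal L L'" "L' \<in> pair_ideal L L'"
  "f \<in> pair_ideal L L' \<Longrightarrow> g \<in> pair_ideal L L' \<Longrightarrow> f + g \<in> pair_ideal L L'"
  "f \<in> pair_ideal L L' \<Longrightarrow> g * f \<in> pair_ideal L L'"
proof -
  have I: "M * L + N * L' \<in> pair_ideal L L'" for M N unfolding pair_ideal_def by blast
  show "0 \<in> pair_ideal L L'" "L \<in> pair_ideal L L'" "L' \<in> pair_ideal L L'"
    using I[of 0 0] I[of 1 0] I[of 0 1] by simp_all
  show "f + g \<in> pair_ideal L L'" if fg: "f \<in> pair_ideal L L'" "g \<in> pair_ideal L L'"
  proof -
    obtain M N M' N' where "f = M * L + N * L'" "g = M' * L + N' * L'"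
      using fg unfolding pair_ideal_def by blast
    then have "f + g = (M + M') * L + (N + N') * L'" by (simp add: algebra_simps)
    then show ?thesis using I by simp
  qed
  show "g * f \<in> pair_ideal L L'" if fg: "f \<in> pair_ideal L L'"
  proof -
    obtain M N where "f = M * L + N * L'"
      using fg unfolding pair_ideal_def by blast
    then have "g * f = (g * M) * L + (g * N) * L'" by (simp add: algebra_simps)
    then show ?thesis using I by simp
  qed
qed

text \<open>The lines L and L' meet in the point (a : b : c). The form u is scaled to have the value 1 there,
  so that modulo L and L' the coordinates are a u, b u and c u. Hence a form is determined modulo
  L and L' by its value at the point.\<close>

locale point_generators =
  fixes L L' u :: "'a::field poly3" and a b c :: 'a
  assumes hom: "homogeneous (Suc 0) L" "homogeneous (Suc 0) L'" "homogeneous (Suc 0) u"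
    and eval: "eval3 L (a, b, c) = 0" "eval3 L' (a, b, c) = 0" "eval3 u (a, b, c) = 1"
    and gens: "X3 - const3 a * u \<in> pair_ideal L L'" "Y3 - const3 b * u \<in> pair_ideal L L'"
      "Z3 - const3 c * u \<in> pair_ideal L L'"
begin

lemma form_cong: "homogeneous d F \<Longrightarrow> F - const3 (eval3 F (a, b, c)) * u ^ d \<in> pair_ideal L L'"
  by (rule homogeneous_cong[OF _ _ _ _ gens]) (auto intro: pair_ideal_closed)

lemma vanishing_form:
  assumes "homogeneous d F" "eval3 F (a, b, c) = 0" shows "F \<in> pair_ideal L L'"
  using form_cong[OF assms(1)] assms(2) by (simp add: const3_def)

lemma point_nonzero: "(a, b, c) \<noteq> (0, 0, 0)"
proof
  assume "(a, b, c) = (0, 0, 0)"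
  then have "(a, b, c) = scale3 0 (0, 0, 0)" by (simp add: scale3_def)
  then have "eval3 u (a, b, c) = 0" using eval3_homogeneous_scale[OF hom(3), of 0 "(0, 0, 0)"] by simp
  then show False using eval by simp
qed

lemma common_zero:
  assumes "eval3 L (x, y, z) = 0" "eval3 L' (x, y, z) = 0"
  shows "(x, y, z) = scale3 (eval3 u (x, y, z)) (a, b, c)"
proof -
  have "eval3 f (x, y, z) = 0" if "f \<in> pair_ideal L L'" for f
    using that assms unfolding pair_ideal_def by auto
  from gens[THEN this] show ?thesis
    unfolding eval3_diff eval3_XYZ eval3_mult eval3_const3 by (simp add: scale3_def mult.commute)
qed

text \<open>At any other point, one of the two lines does not vanish, and the ideal is the whole ring. At the point (a : b : c)
  every element of the local ring differs from its value by an element of the ideal, so that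
  adjoining 1 to the ideal gives the whole ring; and 1 is not in the ideal, whose elements vanish
  there.\<close>

lemma total_intersection_eq_1: "total_intersection L L' 1"
proof -
  define P0 where "P0 = proj_rel `` {(a, b, c)}"
  have P0: "P0 \<in> proj_plane" using point_nonzero by (auto simp: P0_def proj_plane_def quotient_def)
  have v0: "(a, b, c) \<in> P0" using point_nonzero
    by (auto simp: P0_def proj_rel_def scale3_def intro!: exI[of _ 1])
  have other: "fscale.codim (local_ideal P L L') 0 (loc P)" if P: "P \<in> proj_plane" "P \<noteq> P0" for P
  proof -
    obtain v where v: "v \<noteq> (0, 0, 0)" "P = proj_rel `` {v}"
      using P by (auto simp: proj_plane_def quotient_def)
    have "v = scale3 1 v" by (cases v) (simp add: scale3_def)
    then have vP: "v \<in> P" using v by (auto simp: proj_rel_def)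
    obtain x y z where xyz: "v = (x, y, z)" by (cases v)
    have "eval3 L v \<noteq> 0 \<or> eval3 L' v \<noteq> 0"
    proof (rule ccontr)
      assume "\<not> ?thesis"
      then have e: "v = scale3 (eval3 u v) (a, b, c)" using common_zero xyz by simp
      then have "eval3 u v \<noteq> 0" using v(1) by (auto simp: scale3_def)
      then have "(a, b, c) = scale3 (inverse (eval3 u v)) v"
        using arg_cong[OF e, of "scale3 (inverse (eval3 u v))"] by (simp add: scale3_def)
      then have "(v, (a, b, c)) \<in> proj_rel" "((a, b, c), v) \<in> proj_rel"
        using e v(1) point_nonzero unfolding proj_rel_def by auto
      moreover have "trans (proj_rel :: (('a \<times> 'a \<times> 'a) \<times> ('a \<times> 'a \<times> 'a)) set)"
      proof (rule transI)
        fix p q r :: "'a \<times> 'a \<times> 'a" assume "(p, q) \<in> proj_rel" "(q, r) \<in> proj_rel"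
        moreover have "\<exists>c. scale3 d (scale3 e w) = scale3 c w" for d e :: 'a and w
          by (rule exI[of _ "d * e"]) (cases w, simp add: scale3_def mult.assoc)
        ultimately show "(p, r) \<in> proj_rel" unfolding proj_rel_def by (simp, metis)
      qed
      ultimately have "P = P0" unfolding v(2) P0_def Image_singleton by (blast dest: transD)
      then show False using P(2) by blast
    qed
    then show ?thesis
    proof
      assume "eval3 L' v \<noteq> 0"
      then show ?thesis
        using codim_local_ideal_0[OF P(1) hom(1,2)] nonvanishing_at_iff[OF P(1) vP hom(2)] by simp
    next
      assume "eval3 L v \<noteq> 0"
      then show ?thesis
        using codim_local_ideal_0[OF P(1) hom(2,1)] nonvanishing_at_iff[OF P(1) vP hom(1)]
          local_ideal_commute[OF P(1) hom(1,2)] by simp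
    qed
  qed
  have "fscale.codim (local_ideal P0 L L') 1 (loc P0)"
  proof (rule fscale.codim_1I)
    show sub: "fscale.subspace (local_ideal P0 L L')" by (rule subspace_local_ideal[OF P0 hom(1,2)])
    show "1 \<notin> local_ideal P0 L L'"
    proof
      assume "1 \<in> local_ideal P0 L L'"
      then obtain S T d M N where f: "1 = Fract S T" "homogeneous d T" "nonvanishing_at T P0" "T \<noteq> 0"
        "S = M * L + N * L'"
        using P0 by (elim local_idealE)
      then have "S = T" by (simp add: One_fract_def eq_fract)
      then have "T = M * L + N * L'" using f(5) by simp
      then have "eval3 T (a, b, c) = 0" by (simp add: eval)
      then show False using f nonvanishing_at_iff[OF P0 v0 f(2)] by simp
    qed
    show "loc P0 = fscale.adjoin 1 (local_ideal P0 L L')"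
    proof
      show "fscale.adjoin 1 (local_ideal P0 L L') \<subseteq> loc P0"
        by (intro fscale.adjoin_least subspace_loc P0 one_in_loc local_ideal_subset[OF P0 hom(1,2)])
      show "loc P0 \<subseteq> fscale.adjoin 1 (local_ideal P0 L L')"
      proof
        fix f assume "f \<in> loc P0"
        then obtain S T d where f: "f = Fract S T" "homogeneous d S" "homogeneous d T" "nonvanishing_at T P0" "T \<noteq> 0"
          using locE P0 by blast
        have T: "eval3 T (a, b, c) \<noteq> 0" using f nonvanishing_at_iff[OF P0 v0 f(3)] by simp
        \<comment> \<open>the value of f at the point\<close>
        define r where "r = eval3 S (a, b, c) / eval3 T (a, b, c)"
        have hom_S: "homogeneous d (S - const3 r * T)"
          using f by (intro homogeneous_diff homogeneous_const3_mult)
        moreover have "eval3 (S - const3 r * T) (a, b, c) = 0" using T by (simp add: r_def)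
        ultimately have "S - const3 r * T \<in> pair_ideal L L'" by (rule vanishing_form)
        then obtain M N where MN: "S - const3 r * T = M * L + N * L'" unfolding pair_ideal_def by blast
        have "Fract (S - const3 r * T) T \<in> local_ideal P0 L L'"
          by (rule local_idealI[OF hom(1,2) hom_S f(3,4) MN])
        moreover have "f = Fract (S - const3 r * T) T + fscale r 1"
          using f(5) by (simp add: f(1) fscale_def eq_fract algebra_simps)
        ultimately show "f \<in> fscale.adjoin 1 (local_ideal P0 L L')" unfolding fscale.adjoin_def by blast
      qed
    qed
  qed
  with other have "fscale.codim (local_ideal P L L') (if P = P0 then 1 else 0) (loc P)" if "P \<in> proj_plane" for P
    using that by simp
  moreover have "{P \<in> proj_plane. (if P = P0 then 1 else (0 :: nat)) \<noteq> 0} = {P0}" using P0 by auto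
  ultimately show ?thesis
    unfolding total_intersection_def by (intro exI[of _ "\<lambda>P. if P = P0 then 1 else 0"]) simp
qed

end

lemma coeff_mult_top:
  assumes "degree p \<le> a" "degree q \<le> b"
  shows "degree (p * q) \<le> a + b \<and> coeff (p * q) (a + b) = coeff p a * coeff q b"
proof
  show "degree (p * q) \<le> a + b" using assms degree_mult_le[of p q] by linarith
  have "coeff (p * q) (a + b) = (\<Sum>i\<le>a + b. if i = a then coeff p a * coeff q b else 0)"
    unfolding coeff_mult
  proof (rule sum.cong[OF refl])
    fix i assume "i \<in> {..a + b}"
    consider "i < a" | "i = a" | "i > a" by linarith
    then show "coeff p i * coeff q (a + b - i) = (if i = a then coeff p a * coeff q b else 0)"
    proof cases
      case 1
      then have "degree q < a + b - i" using assms by linarith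
      then show ?thesis using 1 by (simp add: coeff_eq_0)
    next
      case 3
      then have "degree p < i" using assms by linarith
      then show ?thesis using 3 by (simp add: coeff_eq_0)
    qed simp
  qed
  then show "coeff (p * q) (a + b) = coeff p a * coeff q b" by simp
qed

lemma coeff_linear_power_top:
  fixes v w :: "'a::comm_semiring_1"
  shows "degree ([:v, w:] ^ i) \<le> i \<and> coeff ([:v, w:] ^ i) i = w ^ i"
proof (induction i)
  case (Suc i)
  then show ?case using coeff_mult_top[of "[:v, w:]" 1 "[:v, w:] ^ i" i] by simp
qed simp

text \<open>The restriction of F to the points v + t w is a polynomial in t of degree at most d, whose
  coefficient at t^d is the value of F at w. If this value is not zero, the polynomial is not
  constant and has a root.\<close>

lemma form_zero_on_line:
  fixes F :: "'a::alg_closed_field poly3"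
  assumes hom: "homogeneous d F" and "d > 0" and w: "eval3 F (w1, w2, w3) \<noteq> 0"
  shows "\<exists>t. eval3 F (v1 + t * w1, v2 + t * w2, v3 + t * w3) = 0"
proof -
  let ?S = "{(i, j, k). coeff3 F i j k \<noteq> 0}"
  define G where "G = (\<Sum>(i, j, k)\<in>?S. smult (coeff3 F i j k) ([:v1, w1:] ^ i * [:v2, w2:] ^ j * [:v3, w3:] ^ k))"
  have "poly G t = eval3 F (v1 + t * w1, v2 + t * w2, v3 + t * w3)" for t
    unfolding G_def poly_sum eval3_expansion[of F "(v1 + t * w1, v2 + t * w2, v3 + t * w3)"]
    by (rule sum.cong) (auto simp only: split_conv eval3_monom3 poly_smult poly_mult poly_power, simp add: mult.assoc)
  moreover have "coeff G d = eval3 F (w1, w2, w3)"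
    unfolding G_def coeff_sum eval3_expansion[of F "(w1, w2, w3)"]
  proof (rule sum.cong[OF refl], clarify)
    fix i j k assume "coeff3 F i j k \<noteq> 0"
    then have d: "d = i + j + k" using hom by (auto simp: homogeneous_def)
    have "coeff ([:v1, w1:] ^ i * [:v2, w2:] ^ j * [:v3, w3:] ^ k) (i + j + k) = w1 ^ i * w2 ^ j * w3 ^ k"
      using coeff_mult_top[of "[:v1, w1:] ^ i" i "[:v2, w2:] ^ j" j]
        coeff_mult_top[of "[:v1, w1:] ^ i * [:v2, w2:] ^ j" "i + j" "[:v3, w3:] ^ k" k]
        coeff_linear_power_top[of v1 w1 i] coeff_linear_power_top[of v2 w2 j] coeff_linear_power_top[of v3 w3 k]
      by simp
    then show "coeff (smult (coeff3 F i j k) ([:v1, w1:] ^ i * [:v2, w2:] ^ j * [:v3, w3:] ^ k)) d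
        = eval3 (monom3 (coeff3 F i j k) i j k) (w1, w2, w3)"
      unfolding eval3_monom3 by (simp add: d mult.assoc)
  qed
  then have "degree G > 0" using w \<open>d > 0\<close> le_degree[of G d] by force
  ultimately show ?thesis using alg_closed_imp_poly_has_root[of G] by metis
qed

text \<open>A line L through the point (0 : 0 : 1). Its other points are the (p : q : t), and u is a linear
  form that vanishes at (0 : 0 : 1) and is scaled to be 1 at the (p, q, t), so that modulo L
  the coordinates x and y are p u and q u.\<close>

locale vertical_line =
  fixes L u :: "'a::field poly3" and p q :: 'a
  assumes hom: "homogeneous (Suc 0) L" "homogeneous (Suc 0) u"
    and eval: "\<And>t. eval3 L (p, q, t) = 0" "\<And>t. eval3 u (p, q, t) = 1"
       "eval3 L (0, 0, 1) = 0" "eval3 u (0, 0, 1) = 0"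
    and dvd: "L dvd X3 - const3 p * u" "L dvd Y3 - const3 q * u"

lemma vertical_line_x: "vertical_line (X3 :: 'a::field poly3) Y3 0 1"
  by unfold_locales
     (simp_all only: homogeneous_XYZ eval3_XYZ, simp_all add: const3_def flip: one_pCons)

lemma vertical_line_y: "vertical_line (Y3 - const3 r * X3 :: 'a::field poly3) X3 1 r"
  by unfold_locales
     (simp_all only: homogeneous_XYZ eval3_XYZ eval3_diff eval3_mult eval3_const3
        homogeneous_diff homogeneous_const3_mult, simp_all add: const3_def flip: one_pCons)

lemma dvd_in_pair_ideal: "L dvd f \<Longrightarrow> f \<in> pair_ideal L L'"
proof -
  assume "L dvd f"
  then obtain k where "f = k * L" by (metis dvdE mult.commute)
  then have "f = k * L + 0 * L'" by simp
  then show ?thesis unfolding pair_ideal_def by blast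
qed

context vertical_line
begin

lemma generators_affine: "point_generators L (Z3 - const3 t * u) u p q t"
proof
  show "homogeneous (Suc 0) (Z3 - const3 t * u)"
    using hom homogeneous_XYZ by (intro homogeneous_diff homogeneous_const3_mult)
  show "eval3 (Z3 - const3 t * u) (p, q, t) = 0"
    unfolding eval3_diff eval3_mult eval3_XYZ eval3_const3 by (simp add: eval)
qed (use hom eval dvd in \<open>auto intro: dvd_in_pair_ideal pair_ideal_closed\<close>)

lemma generators_infinite: "point_generators L u Z3 0 0 1"
proof
  have "X3 - const3 0 * Z3 = (X3 - const3 p * u) + const3 p * u" by (simp add: const3_def)
  also have "\<dots> \<in> pair_ideal L u" using dvd by (intro pair_ideal_closed dvd_in_pair_ideal)
  finally show "X3 - const3 0 * Z3 \<in> pair_ideal L u" .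
  have "Y3 - const3 0 * Z3 = (Y3 - const3 q * u) + const3 q * u" by (simp add: const3_def)
  also have "\<dots> \<in> pair_ideal L u" using dvd by (intro pair_ideal_closed dvd_in_pair_ideal)
  finally show "Y3 - const3 0 * Z3 \<in> pair_ideal L u" .
  show "Z3 - const3 1 * Z3 \<in> pair_ideal L u" by (simp add: pair_ideal_closed flip: one_const3)
  show "eval3 Z3 (0, 0, 1) = 1" by (rule eval3_XYZ)
qed (use hom eval homogeneous_XYZ in auto)

end

lemma coprime_dvd_mult:
  fixes A B :: "'a::ring_gcd"
  assumes "coprime A B" "B dvd M * A" shows "B dvd M"
  using assms by (simp add: coprime_commute coprime_dvd_mult_left_iff)

text \<open>If A is not constant, it has a zero on L. Modulo L it is therefore a product N' L', where L' is a
  second line through that zero. So L meets A in one point more than it meets N', a form of smaller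
  degree.\<close>

lemma total_intersection_vertical_line:
  fixes A :: "'a::{alg_closed_field, field_gcd} poly3"
  assumes L: "vertical_line L u p q" and "homogeneous m A" "A \<noteq> 0" "coprime L A"
  shows "total_intersection L A m"
  using assms(2-)
proof (induction m arbitrary: A)
  case 0
  then obtain c where "A = const3 c" using homogeneous_0_const by blast
  moreover from this have "c \<noteq> 0" using 0 by (auto simp: const3_def)
  ultimately show ?case using total_intersection_const vertical_line.hom[OF L] by blast
next
  case (Suc m)
  interpret L: vertical_line L u p q by (rule L)
  have "\<exists>L' u' a b c. point_generators L L' u' a b c \<and> eval3 A (a, b, c) = 0"
  proof (cases "eval3 A (0, 0, 1) = 0")
    case True
    then show ?thesis using L.generators_infinite by blast
  next
    case False
    then obtain t where "eval3 A (p, q, t) = 0"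
      using form_zero_on_line[OF Suc.prems(1) _ False, of p q 0] by auto
    then show ?thesis using L.generators_affine by blast
  qed
  then obtain L' u' a b c where "point_generators L L' u' a b c" and zero: "eval3 A (a, b, c) = 0" by blast
  then interpret G: point_generators L L' u' a b c by simp
  obtain M N where MN: "A = M * L + N * L'"
    using G.vanishing_form[OF Suc.prems(1) zero] unfolding pair_ideal_def by blast
  obtain M' N' where MN': "tdeg_in {e. e + Suc 0 = Suc m} M'" "tdeg_in {e. e + Suc 0 = Suc m} N'" "A = M' * L + N' * L'"
    using homogeneous_cofactors[OF Suc.prems(1) G.hom(1,2) MN] .
  have hom: "homogeneous m M'" "homogeneous m N'"
    using MN' by (simp_all add: homogeneous_tdeg_in)
  have NL: "homogeneous (Suc m) (N' * L')" using homogeneous_mult[OF hom(2) G.hom(2)] by simp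
  have "coprime L (N' * L')"
  proof (rule coprimeI)
    fix D assume "D dvd L" "D dvd N' * L'"
    then have "D dvd A" unfolding MN'(3) by simp
    with \<open>D dvd L\<close> show "is_unit D" using Suc.prems(3) coprime_common_divisor by blast
  qed
  then have cop: "coprime L N'" "coprime L L'" by simp_all
  have N0: "N' \<noteq> 0"
  proof
    assume "N' = 0"
    then have "L dvd 1" using cop by simp
    then obtain c where "c \<noteq> 0" "L = const3 c" by (rule is_unit_poly3)
    then show False using G.eval(1) by simp
  qed
  have "total_intersection L (N' * L') (m + 1)"
    by (rule total_intersection_mult[OF G.hom(1) hom(2) G.hom(2) coprime_dvd_mult[OF cop(1)] N0
          Suc.IH[OF hom(2) N0 cop(1)] G.total_intersection_eq_1])
  moreover have "A = N' * L' + M' * L" by (simp add: MN'(3))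
  ultimately show ?case
    using total_intersection_reduce[OF G.hom(1) NL, of M'] Suc.prems(1) by simp
qed

text \<open>A nonconstant form in x and y has a zero of the shape (p : q : 0), and its values at the (p, q, t)
  do not depend on t; so it vanishes on the line that joins this zero to (0 : 0 : 1).\<close>

lemma vertical_line_factor:
  fixes s :: "'a::alg_closed_field poly poly"
  assumes hom: "homogeneous (Suc n) [:s:]"
  shows "\<exists>L u p q. vertical_line L u p q \<and> L dvd [:s:]"
proof -
  have "\<exists>L u p q. vertical_line L u p q \<and> degree L = 0 \<and> eval3 [:s:] (p, q, 0) = 0"
  proof (cases "eval3 [:s:] (0, 1, 0) = 0")
    case True
    moreover have "degree (X3 :: 'a poly3) = 0" by (simp add: monom_0)
    ultimately show ?thesis using vertical_line_x by blast
  next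
    case False
    then obtain r where "eval3 [:s:] (1, r, 0) = 0"
      using form_zero_on_line[OF hom _ False, of 1 0 0] by auto
    moreover have "degree (Y3 - const3 r * X3 :: 'a poly3) = 0"
      by (simp add: monom_0 const3_def)
    ultimately show ?thesis using vertical_line_y by blast
  qed
  then obtain L u p q where L: "vertical_line L u p q" and "degree L = 0" and zero: "eval3 [:s:] (p, q, 0) = 0"
    by blast
  then obtain l where l: "L = [:l:]" using degree_eq_zeroE by blast
  interpret L: vertical_line L u p q by (rule L)
  interpret G: point_generators L "Z3 - const3 0 * u" u p q 0 by (rule L.generators_affine)
  obtain M N where MN: "[:s:] = M * L + N * (Z3 - const3 0 * u)"
    using G.vanishing_form[OF hom zero] unfolding pair_ideal_def by blast
  \<comment> \<open>put z = 0\<close>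
  have "coeff [:s:] 0 = coeff M 0 * l"
    unfolding MN by (simp add: const3_def l coeff_mult_0 mult.commute)
  then have "[:s:] = L * [:coeff M 0:]" by (simp add: l mult.commute)
  then show ?thesis using L by (metis dvd_triv_left)
qed

text \<open>Bezout's theorem for a form without z, by splitting off one line through (0 : 0 : 1) after the
  other.\<close>

lemma total_intersection_flat:
  fixes A :: "'a::{alg_closed_field, field_gcd} poly3"
  assumes "homogeneous m A" "A \<noteq> 0" "homogeneous n [:s:]" "s \<noteq> 0" "coprime A [:s:]"
  shows "total_intersection A [:s:] (m * n)"
  using assms(3-)
proof (induction n arbitrary: s)
  case 0
  then obtain c where "[:s:] = const3 c" using homogeneous_0_const by blast
  moreover from this have "c \<noteq> 0" using 0 by (auto simp: const3_def)
  ultimately show ?case using total_intersection_const[OF assms(1)] by simp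
next
  case (Suc n)
  obtain L u p q where L: "vertical_line L u p q" "L dvd [:s:]"
    using vertical_line_factor[OF Suc.prems(1)] by blast
  interpret L: vertical_line L u p q by (rule L(1))
  obtain C where C: "[:s:] = C * L" using L(2) by (metis dvdE mult.commute)
  have nz: "C \<noteq> 0" "L \<noteq> 0" using C Suc.prems(2) by auto
  have "degree (C * L) = 0" unfolding C[symmetric] by simp
  then have "degree C + degree L = 0" by (simp only: degree_mult_eq[OF nz])
  then obtain s' where s': "C = [:s':]" using degree_eq_zeroE by auto
  obtain d e where de: "homogeneous d C" "homogeneous e L" "Suc n = d + e"
  proof (rule homogeneous_factor)
    show "homogeneous (Suc n) (C * L)" using Suc.prems(1) C by simp
    show "C * L \<noteq> 0" using nz by simp
  qed
  have "e = 1" using homogeneous_unique[OF de(2) L.hom(1) nz(2)] by simp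
  then have hom_C: "homogeneous n [:s':]" using de s' by simp
  have cop: "coprime A C" "coprime A L" using Suc.prems(3) unfolding C by simp_all
  have "total_intersection A C (m * n)"
    unfolding s' by (rule Suc.IH[OF hom_C]) (use nz s' cop in auto)
  moreover have "total_intersection A L m"
    using total_intersection_vertical_line[OF L(1) assms(1,2)] cop(2)
      total_intersection_commute[OF L.hom(1) assms(1)] by (simp add: coprime_commute)
  ultimately have "total_intersection A (C * L) (m * n + m)"
    using hom_C s' by (intro total_intersection_mult[OF assms(1) _ L.hom(1) coprime_dvd_mult[OF cop(1)] nz(1)]) auto
  then show ?case by (simp add: C add.commute)
qed

section \<open>The Euclidean algorithm\<close>

lemma homogeneous_lead_coeff:
  assumes "homogeneous n A" "A \<noteq> 0"
  shows "degree A \<le> n" "homogeneous (n - degree A) [:lead_coeff A:]"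
proof -
  have c: "coeff3 [:lead_coeff A:] i j k = (if k = 0 then coeff3 A i j (degree A) else 0)" for i j k
    by (cases k) (simp_all add: coeff3_def)
  have "[:lead_coeff A:] \<noteq> 0" using assms by simp
  then obtain i j k where "coeff3 [:lead_coeff A:] i j k \<noteq> 0" by (rule nonzero_coeff3)
  then have "i + j + degree A = n" using assms(1) by (auto simp: c homogeneous_def split: if_splits)
  then show "degree A \<le> n" by simp
  show "homogeneous (n - degree A) [:lead_coeff A:]"
    using assms(1) by (fastforce simp: homogeneous_def c split: if_splits)
qed

lemma monom_factored: "monom s k = [:s:] * (Z3 :: 'a::comm_semiring_1 poly3) ^ k"
  by (simp add: monom_power smult_monom one_pCons[symmetric] monom_0)

text \<open>One step of the algorithm, with the theorem assumed for pairs with a smaller sum of z-degrees. The content c1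
  of B is a form in x and y, and B1 = B / c1 has no nonconstant factor of z-degree 0; so the leading
  coefficient L of B1 is coprime to B1. In A' = L A - Q B1 the leading terms in z cancel. If b is
  the z-degree of B1 and n2 its degree, then L has degree n2 - b, and the numbers for A' and L give
  (n2 - b + m) n2 - (n2 - b) n2 = m n2 for A and B1.\<close>

lemma bezout_euclid_step:
  fixes A B :: "'a::{alg_closed_field, field_gcd} poly3"
  assumes IH: "\<And>(A' :: 'a poly3) B' m' n'. degree A' + degree B' < degree A + degree B \<Longrightarrow> homogeneous m' A' \<Longrightarrow>
      homogeneous n' B' \<Longrightarrow> A' \<noteq> 0 \<Longrightarrow> B' \<noteq> 0 \<Longrightarrow> coprime A' B' \<Longrightarrow> total_intersection A' B' (m' * n')"
    and hom: "homogeneous m A" "homogeneous n B" and nz: "A \<noteq> 0" "B \<noteq> 0" and cop: "coprime A B"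
    and le: "degree B \<le> degree A"
  shows "total_intersection A B (m * n)"
proof (cases "degree B = 0")
  case True
  then obtain s where "B = [:s:]" by (rule degree_eq_zeroE)
  then show ?thesis using total_intersection_flat[OF hom(1) nz(1)] hom(2) nz(2) cop by auto
next
  case False
  define c1 B1 where "c1 = [:content B:]" and "B1 = primitive_part B"
  have B: "B = c1 * B1" by (simp add: c1_def B1_def)
  have nz1: "c1 \<noteq> 0" "B1 \<noteq> 0" using nz B by auto
  obtain n1 n2 where hom1: "homogeneous n1 c1" "homogeneous n2 B1" "n = n1 + n2"
  proof (rule homogeneous_factor)
    show "homogeneous n (c1 * B1)" "c1 * B1 \<noteq> 0" using hom(2) nz(2) B by simp_all
  qed
  have cop1: "coprime A c1" "coprime A B1" using cop unfolding B by simp_all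
  have content: "content B1 = 1" using nz by (simp add: B1_def)
  have deg: "degree B1 = degree B" by (simp add: B1_def)
  have total_c1: "total_intersection A c1 (m * n1)"
    unfolding c1_def
    by (rule total_intersection_flat[OF hom(1) nz(1)]) (use hom1 nz1 cop1 c1_def in auto)
  define a b where "a = degree A" and "b = degree B1"
  define L where "L = [:lead_coeff B1:]"
  have L: "b \<le> n2" "homogeneous (n2 - b) L" "L \<noteq> 0"
    using homogeneous_lead_coeff[OF hom1(2) nz1(2)] nz1 by (auto simp: b_def L_def)
  have cop_L: "coprime L B1"
  proof (rule coprimeI)
    fix D assume D: "D dvd L" "D dvd B1"
    then have "degree D = 0" using dvd_imp_degree_le[OF D(1) L(3)] by (simp add: L_def)
    then obtain d where d: "D = [:d:]" by (rule degree_eq_zeroE)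
    then have "d dvd content B1" using D(2) by (simp add: const_poly_dvd_iff_dvd_content)
    then show "is_unit D" using d content by (simp add: is_unit_const_poly_iff)
  qed
  define Q where "Q = monom (lead_coeff A) (a - b)"
  define A' where "A' = L * A + (- Q) * B1"
  have "homogeneous ((m - a) + (a - b)) Q"
  proof -
    have "homogeneous (a - b) (Z3 ^ (a - b) :: 'a poly3)"
      using homogeneous_power[OF homogeneous_XYZ(3), of "a - b"] by (simp only: mult_Suc mult_0 add_0_right)
    from homogeneous_mult[OF homogeneous_lead_coeff(2)[OF hom(1) nz(1)] this]
    show ?thesis unfolding a_def[symmetric] Q_def by (subst monom_factored)
  qed
  from homogeneous_mult[OF homogeneous_minus[OF this] hom1(2)]
  have hom_Q: "homogeneous ((m - a) + (a - b) + n2) ((- Q) * B1)" .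
  have degs: "(m - a) + (a - b) + n2 = (n2 - b) + m"
    using homogeneous_lead_coeff(1)[OF hom(1) nz(1)] L(1) le deg by (simp add: a_def b_def)
  have hom_LA: "homogeneous ((n2 - b) + m) (L * A)" by (rule homogeneous_mult[OF L(2) hom(1)])
  have hom_A': "homogeneous ((n2 - b) + m) A'"
    unfolding A'_def by (rule homogeneous_add[OF hom_LA hom_Q[unfolded degs]])
  have cop_A': "coprime A' B1"
  proof (rule coprimeI)
    fix D assume D: "D dvd A'" "D dvd B1"
    have "L * A = A' + Q * B1" by (simp add: A'_def)
    then have "D dvd L * A" using D by simp
    moreover have "coprime (L * A) B1" using cop_L cop1 by simp
    ultimately show "is_unit D" using D(2) coprime_common_divisor by blast
  qed
  have A'0: "A' \<noteq> 0"
  proof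
    assume "A' = 0"
    then have "is_unit B1" using cop_A' by simp
    then obtain c where "B1 = const3 c" by (rule is_unit_poly3)
    then show False using False deg by (simp add: const3_def)
  qed
  have "degree A' < a"
  proof -
    have ba: "b \<le> a" "0 < a" using le deg False by (simp_all add: a_def b_def)
    have "degree (L * A) \<le> a" using degree_mult_le[of L A] by (simp add: L_def a_def)
    moreover have "degree (Q * B1) \<le> a"
      using degree_mult_le[of Q B1] degree_monom_le[of "lead_coeff A" "a - b"] ba by (simp add: Q_def b_def)
    ultimately have "degree A' \<le> a" unfolding A'_def by (simp add: degree_diff_le)
    moreover have "coeff (Q * B1) a = lead_coeff A * lead_coeff B1"
      using ba by (simp add: Q_def coeff_monom_mult b_def)
    then have "coeff A' a = 0" by (simp add: A'_def L_def a_def mult.commute)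
    ultimately show ?thesis using ba A'0 by (metis leading_coeff_0_iff le_neq_implies_less)
  qed
  then have "total_intersection A' B1 (((n2 - b) + m) * n2)"
    using deg by (intro IH[OF _ hom_A' hom1(2) A'0 nz1(2) cop_A']) (simp add: a_def)
  then have "total_intersection B1 A' (((n2 - b) + m) * n2)"
    using total_intersection_commute[OF hom_A' hom1(2)] by simp
  then have "total_intersection B1 (L * A) (((n2 - b) + m) * n2)"
    using total_intersection_reduce[OF hom1(2) hom_LA, of "- Q"] hom_A' by (simp add: A'_def)
  moreover have "((n2 - b) + m) * n2 = m * n2 + n2 * (n2 - b)" using add_mult_distrib[of "n2 - b" m n2] by (simp only: ac_simps)
  ultimately have "total_intersection B1 (A * L) (m * n2 + n2 * (n2 - b))"
    by (simp only: mult.commute[of L A])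
  moreover have "total_intersection B1 L (n2 * (n2 - b))"
    unfolding L_def
    by (rule total_intersection_flat[OF hom1(2) nz1(2)])
       (use L cop_L in \<open>auto simp: L_def coprime_commute\<close>)
  ultimately have "total_intersection B1 A (m * n2)"
    using cop1(2)
    by (intro total_intersection_cancel[OF hom1(2) hom(1) L(2) coprime_dvd_mult nz(1)])
       (simp_all add: coprime_commute)
  then have total_B1: "total_intersection A B1 (m * n2)"
    using total_intersection_commute[OF hom1(2) hom(1)] by simp
  have "total_intersection A (c1 * B1) (m * n1 + m * n2)"
    by (rule total_intersection_mult[OF hom(1) hom1(1,2) coprime_dvd_mult[OF cop1(1)] nz1(1) total_c1 total_B1])
  then show ?thesis by (simp add: B hom1(3) distrib_left)
qed

theorem bezout_coprime:
  fixes A B :: "'a::{alg_closed_field, field_gcd} poly3"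
  assumes "homogeneous m A" "homogeneous n B" "A \<noteq> 0" "B \<noteq> 0" "coprime A B"
  shows "total_intersection A B (m * n)"
  using assms
proof (induction "degree A + degree B" arbitrary: A B m n rule: less_induct)
  case less
  show ?case
  proof (cases "degree B \<le> degree A")
    case True
    show ?thesis by (rule bezout_euclid_step[OF _ less.prems True]) (use less.hyps in blast)
  next
    case False
    have "total_intersection B A (n * m)"
      by (rule bezout_euclid_step[OF _ less.prems(2,1,4,3)])
         (use less.hyps less.prems(5) False in \<open>auto simp: coprime_commute add.commute\<close>)
    then show ?thesis
      using total_intersection_commute[OF less.prems(2,1)] by (simp add: mult.commute)
  qed
qed

section \<open>Extension of the ground field\<close>

lemma coeff3_map_poly3: "f 0 = 0 \<Longrightarrow> coeff3 (map_poly3 f p) i j k = f (coeff3 p i j k)"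
  by (simp add: coeff3_def map_poly3_def coeff_map_poly)

text \<open>Besides ring homomorphisms (with g the identity and h = f), this covers maps f that are only
  linear over a subfield: then g is the inclusion of the subfield and h the identity.\<close>

lemma map_poly3_mult:
  fixes f :: "'c::comm_semiring_0 \<Rightarrow> 'b::comm_semiring_0" and g :: "'a::comm_semiring_0 \<Rightarrow> 'c" and h :: "'a \<Rightarrow> 'b"
  assumes add: "\<And>x y. f (x + y) = f x + f y" and zero: "f 0 = 0" "g 0 = 0" "h 0 = 0"
    and mult: "\<And>x y. f (x * g y) = f x * h y"
  shows "map_poly3 f (p * map_poly3 g q) = map_poly3 f p * map_poly3 h q"
proof -
  have sum: "f (sum F S) = (\<Sum>s\<in>S. f (F s))" for F and S :: "nat set"
    by (induction S rule: infinite_finite_induct) (simp_all add: add zero)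
  show ?thesis
    by (rule poly3_eqI) (simp add: coeff3_mult coeff3_map_poly3 zero sum mult)
qed

lemma map_poly3_id: "map_poly3 (\<lambda>x. x) p = p"
  by (rule poly3_eqI) (simp add: coeff3_map_poly3)

lemma map_poly3_hom_mult:
  fixes f :: "'a::comm_semiring_0 \<Rightarrow> 'b::comm_semiring_0"
  assumes "\<And>x y. f (x + y) = f x + f y" "f 0 = 0" "\<And>x y. f (x * y) = f x * f y"
  shows "map_poly3 f (p * q) = map_poly3 f p * map_poly3 f q"
  using map_poly3_mult[of f "\<lambda>x. x" f p q] assms by (simp add: map_poly3_id)

lemma map_poly3_comp: "f 0 = 0 \<Longrightarrow> g 0 = 0 \<Longrightarrow> map_poly3 f (map_poly3 g p) = map_poly3 (\<lambda>x. f (g x)) p"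
  by (rule poly3_eqI) (simp add: coeff3_map_poly3)

lemma map_poly3_const3: "f 0 = 0 \<Longrightarrow> map_poly3 f (const3 c) = const3 (f c)"
  by (rule poly3_eqI) (simp add: coeff3_map_poly3 const3_monom3 coeff3_monom3)

text \<open>Every field is isomorphic to a type of the class \<open>field_gcd\<close>. Polynomial rings over such types are
  instances of the classes of factorial rings.\<close>

datatype 'a field_copy = Copy (orig: 'a)

instantiation field_copy :: (field) field
begin
definition "0 = Copy 0"
definition "1 = Copy 1"
definition "x + y = Copy (orig x + orig y)"
definition "x - y = Copy (orig x - orig y)"
definition "- x = Copy (- orig x)"
definition "x * y = Copy (orig x * orig y)"
definition "inverse x = Copy (inverse (orig x))"
definition "x div y = Copy (orig x / orig y)"
instance
  by standard
     (auto simp: zero_field_copy_def one_field_copy_def plus_field_copy_def minus_field_copy_def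
        uminus_field_copy_def times_field_copy_def inverse_field_copy_def divide_field_copy_def
        algebra_simps divide_inverse intro: field_copy.expand,
      metis field_copy.collapse right_inverse)
end

instantiation field_copy :: (field)
  "{unique_euclidean_ring, normalization_euclidean_semiring, normalization_semidom_multiplicative}"
begin
definition [simp]: "normalize_field_copy = (normalize_field :: 'a field_copy \<Rightarrow> _)"
definition [simp]: "unit_factor_field_copy = (unit_factor_field :: 'a field_copy \<Rightarrow> _)"
definition [simp]: "modulo_field_copy = (mod_field :: 'a field_copy \<Rightarrow> _)"
definition [simp]: "euclidean_size_field_copy = (euclidean_size_field :: 'a field_copy \<Rightarrow> _)"
definition [simp]: "division_segment (x :: 'a field_copy) = 1"
instance
  by standard (simp_all add: dvd_field_iff field_split_simps split: if_splits)
end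

instantiation field_copy :: (field) euclidean_ring_gcd
begin
definition gcd_field_copy :: "'a field_copy \<Rightarrow> 'a field_copy \<Rightarrow> 'a field_copy" where
  "gcd_field_copy = Euclidean_Algorithm.gcd"
definition lcm_field_copy :: "'a field_copy \<Rightarrow> 'a field_copy \<Rightarrow> 'a field_copy" where
  "lcm_field_copy = Euclidean_Algorithm.lcm"
definition Gcd_field_copy :: "'a field_copy set \<Rightarrow> 'a field_copy" where
  "Gcd_field_copy = Euclidean_Algorithm.Gcd"
definition Lcm_field_copy :: "'a field_copy set \<Rightarrow> 'a field_copy" where
  "Lcm_field_copy = Euclidean_Algorithm.Lcm"
instance
  by standard (simp_all add: gcd_field_copy_def lcm_field_copy_def Gcd_field_copy_def Lcm_field_copy_def)
end

instance field_copy :: (field) field_gcd ..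

lemma map_poly3_copy_mult:
  "map_poly3 Copy (p * q) = map_poly3 Copy p * map_poly3 Copy q"
  "map_poly3 orig (r * s) = map_poly3 orig r * map_poly3 orig s"
  by (rule map_poly3_hom_mult;
      simp add: zero_field_copy_def plus_field_copy_def times_field_copy_def)+

lemma map_poly3_copy_inverse:
  "map_poly3 orig (map_poly3 Copy p) = (p :: 'a::field poly3)"
  "map_poly3 Copy (map_poly3 orig q) = (q :: 'a field_copy poly3)"
  by (simp_all add: map_poly3_comp zero_field_copy_def map_poly3_id)

lemma no_common_factor_nonzero:
  fixes A B :: "'a::field poly3"
  assumes "no_nonconst_common_factor A B" shows "A \<noteq> 0 \<or> B \<noteq> 0"
proof (rule ccontr)
  assume "\<not> ?thesis"
  then have "X3 \<in> range (const3 :: 'a \<Rightarrow> 'a poly3)"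
    using assms unfolding no_nonconst_common_factor_def by simp
  then obtain c :: 'a where "X3 = const3 c" by blast
  then have "coeff3 X3 1 0 0 = coeff3 (const3 c) 1 0 0" by simp
  then show False unfolding coeff3_monom3 const3_monom3 by simp
qed

lemma no_common_factor_dvd:
  fixes A B :: "'a::field poly3"
  assumes nc: "no_nonconst_common_factor A B" and eq: "M * A = N * B"
  shows "B dvd M"
proof -
  have dvd_map: "map_poly3 orig p dvd map_poly3 orig q" if "p dvd q" for p q :: "'a field_copy poly3"
    using that by (auto simp: map_poly3_copy_mult elim!: dvdE)
  have "coprime (map_poly3 Copy A) (map_poly3 Copy B)"
  proof (rule coprimeI)
    fix D assume D: "D dvd map_poly3 Copy A" "D dvd map_poly3 Copy B"
    then have *: "map_poly3 orig D dvd A" "map_poly3 orig D dvd B"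
      using dvd_map by (metis map_poly3_copy_inverse(1))+
    then obtain c where c: "map_poly3 orig D = const3 c"
      using nc unfolding no_nonconst_common_factor_def by blast
    have "c \<noteq> 0" using * no_common_factor_nonzero[OF nc] unfolding c by (auto simp: const3_def)
    have "D = map_poly3 Copy (const3 c)" using map_poly3_copy_inverse(2)[of D] c by simp
    also have "\<dots> = const3 (Copy c)" by (rule map_poly3_const3) (simp add: zero_field_copy_def)
    finally show "is_unit D" using \<open>c \<noteq> 0\<close> by (simp add: is_unit_const3 zero_field_copy_def)
  qed
  moreover have "map_poly3 Copy B dvd map_poly3 Copy M * map_poly3 Copy A"
    by (simp add: eq flip: map_poly3_copy_mult) (simp add: map_poly3_copy_mult)
  ultimately have "map_poly3 Copy B dvd map_poly3 Copy M" by (rule coprime_dvd_mult)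
  from dvd_map[OF this] show ?thesis by (simp add: map_poly3_copy_inverse)
qed

text \<open>Suppose that D is a common factor over the algebraic closure, with A = D A1 and B = D B1. Then
  B1 A = A1 B. Taking coordinates with respect to a K-basis of the closure gives the same relation
  over K for each coordinate of B1 and A1, so that B divides every coordinate of B1, and hence B1
  itself. As B = D B1, this makes D a unit if B is not zero. If B is zero, then A is a constant.\<close>

lemma coprime_map_to_ac:
  fixes A B :: "'a::field poly3"
  assumes nc: "no_nonconst_common_factor A B"
  shows "coprime (map_poly3 to_ac A) (map_poly3 to_ac B)"
proof (rule coprimeI)
  let ?A = "map_poly3 to_ac A" and ?B = "map_poly3 to_ac B"
  fix D assume D: "D dvd ?A" "D dvd ?B"
  interpret V: vector_space "\<lambda>(c :: 'a) x. to_ac c * x"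
    by unfold_locales (simp_all add: algebra_simps)
  obtain E where E: "V.independent E" "UNIV \<subseteq> V.span E"
    by (rule V.maximal_independent_subset_extend[OF subset_UNIV V.independent_empty])
  have span: "x \<in> V.span E" for x using E(2) by (rule subsetD) simp
  \<comment> \<open>the K-linear coordinate of x at the basis element b\<close>
  define \<phi> where "\<phi> = (\<lambda>b x. V.representation E x b)"
  have \<phi>_add: "\<phi> b (x + y) = \<phi> b x + \<phi> b y" for b x y
    unfolding \<phi>_def V.representation_add[OF E(1) span span] ..
  have \<phi>_scale: "\<phi> b (x * to_ac c) = \<phi> b x * c" for b x c
    unfolding \<phi>_def mult.commute[of x] V.representation_scale[OF E(1) span] by (rule mult.commute)
  have \<phi>_0: "\<phi> b 0 = 0" for b unfolding \<phi>_def by (simp add: V.representation_zero)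
  show "is_unit D"
  proof (cases "B = 0")
    case True
    have "A dvd A \<and> A dvd B" using True by simp
    then have "A \<in> range const3" using nc unfolding no_nonconst_common_factor_def by blast
    moreover have "A \<noteq> 0" using no_common_factor_nonzero[OF nc] True by simp
    ultimately obtain c where "A = const3 c" "c \<noteq> 0" by (auto simp: const3_def)
    then have "is_unit ?A" by (simp add: map_poly3_const3 is_unit_const3)
    then show ?thesis using D(1) dvd_trans by blast
  next
    case False
    have B0: "?B \<noteq> 0"
    proof
      assume "?B = 0"
      then have "to_ac (coeff3 B i j k) = 0" for i j k
        by (metis coeff3_0 coeff3_map_poly3 to_ac_0)
      then show False using False poly3_eqI[of B 0] by simp
    qed
    obtain A1 where A1: "?A = D * A1" using D(1) by (rule dvdE)
    obtain B1 where B1: "?B = D * B1" using D(2) by (rule dvdE)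
    have eq: "B1 * ?A = A1 * ?B" unfolding A1 B1 by (simp only: ac_simps)
    have dvd: "B dvd map_poly3 (\<phi> b) B1" for b
    proof (rule no_common_factor_dvd[OF nc])
      have *: "map_poly3 (\<phi> b) (p * map_poly3 to_ac q) = map_poly3 (\<phi> b) p * q" for p q
        using map_poly3_mult[of "\<phi> b" to_ac "\<lambda>x. x" p q] by (simp add: \<phi>_add \<phi>_0 \<phi>_scale map_poly3_id)
      show "map_poly3 (\<phi> b) B1 * A = map_poly3 (\<phi> b) A1 * B"
        using arg_cong[OF eq, of "map_poly3 (\<phi> b)"] unfolding * .
    qed
    define F where "F = (\<Union>(i, j, k)\<in>{(i, j, k). coeff3 B1 i j k \<noteq> 0}. {b. \<phi> b (coeff3 B1 i j k) \<noteq> 0})"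
    have F: "finite F"
      unfolding F_def by (intro finite_UN_I finite_coeff3) (auto simp: \<phi>_def V.finite_representation)
    have B1_sum: "B1 = (\<Sum>b\<in>F. const3 b * map_poly3 to_ac (map_poly3 (\<phi> b) B1))"
    proof (rule poly3_eqI)
      fix i j k
      have const3_mult: "coeff3 (const3 b * p) i j k = b * coeff3 p i j k" for b and p :: "'a alg_closure poly3"
        by (simp add: const3_def coeff3_def)
      have "(\<Sum>b\<in>F. b * to_ac (\<phi> b (coeff3 B1 i j k))) = (\<Sum>b | \<phi> b (coeff3 B1 i j k) \<noteq> 0. b * to_ac (\<phi> b (coeff3 B1 i j k)))"
      proof (rule sum.mono_neutral_right[OF F])
        show "{b. \<phi> b (coeff3 B1 i j k) \<noteq> 0} \<subseteq> F"
        proof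
          fix b assume b: "b \<in> {b. \<phi> b (coeff3 B1 i j k) \<noteq> 0}"
          then have "coeff3 B1 i j k \<noteq> 0" using \<phi>_0 by (metis mem_Collect_eq)
          with b show "b \<in> F" unfolding F_def by blast
        qed
      qed auto
      also have "\<dots> = coeff3 B1 i j k"
        using V.sum_nonzero_representation_eq[OF E(1) span, of "coeff3 B1 i j k"]
        by (simp only: \<phi>_def mult.commute)
      finally show "coeff3 B1 i j k = coeff3 (\<Sum>b\<in>F. const3 b * map_poly3 to_ac (map_poly3 (\<phi> b) B1)) i j k"
        by (simp add: coeff3_sum const3_mult coeff3_map_poly3 \<phi>_0)
    qed
    have *: "?B dvd map_poly3 to_ac (map_poly3 (\<phi> b) B1)" for b
    proof -
      obtain q where q: "map_poly3 (\<phi> b) B1 = B * q" using dvd by (rule dvdE)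
      have "map_poly3 to_ac (B * q) = ?B * map_poly3 to_ac q" by (rule map_poly3_hom_mult) simp_all
      then show ?thesis unfolding q by (rule dvdI)
    qed
    have "?B dvd (\<Sum>b\<in>F. const3 b * map_poly3 to_ac (map_poly3 (\<phi> b) B1))"
      by (rule dvd_sum) (rule dvd_mult[OF *])
    then have "?B dvd B1" by (simp only: B1_sum[symmetric])
    then obtain C where "B1 = ?B * C" by (rule dvdE)
    then have "?B * 1 = D * (?B * C)" using B1 by (metis mult_1_right)
    then have "?B * 1 = ?B * (D * C)" by (simp only: mult.left_commute)
    then have "1 = D * C" using B0 by (simp only: mult_cancel_left) simp
    then show ?thesis by (rule dvdI)
  qed
qed

section \<open>Bezout's theorem\<close>

instance alg_closure :: (field) field_gcd ..

lemma homogeneous_map_to_ac: "homogeneous d p \<Longrightarrow> homogeneous d (map_poly3 to_ac p)"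
  by (simp add: homogeneous_def coeff3_map_poly3)

lemma sum_enat: "(\<Sum>x\<in>S. enat (f x)) = enat (sum f S)"
  by (simp add: of_nat_eq_enat[symmetric])

text \<open>If one of the forms is zero, then the other one is a nonzero constant, and both sides are zero.\<close>

lemma total_intersection_coprime:
  fixes A B :: "'a::{alg_closed_field, field_gcd} poly3"
  assumes hom: "homogeneous m A" "homogeneous n B" and cop: "coprime A B"
  shows "total_intersection A B (m * n)"
proof -
  have zero: "total_intersection A B (m * n)"
    if hom: "homogeneous m A" "homogeneous n B" and cop: "coprime A B" and "A = 0"
    for A B :: "'a poly3" and m n
  proof -
    have "is_unit B" using cop \<open>A = 0\<close> by simp
    then obtain c where c: "c \<noteq> 0" "B = const3 c" by (rule is_unit_poly3)
    then have "B \<noteq> 0" by (simp add: const3_def)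
    moreover have "homogeneous 0 B" by (simp add: c)
    ultimately have "n = 0" using homogeneous_unique hom(2) by blast
    then show ?thesis using total_intersection_const[OF hom(1) c(1)] c(2) by simp
  qed
  consider "A = 0" | "B = 0" | "A \<noteq> 0" "B \<noteq> 0" by blast
  then show ?thesis
  proof cases
    case 1
    then show ?thesis using zero hom cop by blast
  next
    case 2
    then have "total_intersection B A (n * m)" using zero hom cop by (simp add: coprime_commute)
    then show ?thesis using total_intersection_commute[OF hom(2,1)] by (simp add: mult.commute)
  next
    case 3
    then show ?thesis using bezout_coprime hom cop by blast
  qed
qed

theorem theorem1:
  fixes A B :: "'a::field poly3" and m n :: nat
  assumes "homogeneous m A" and "homogeneous n B"
    and "no_nonconst_common_factor A B"
  shows "let i = (\<lambda>P. intersection_mult P (map_poly3 to_ac A) (map_poly3 to_ac B));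
             Z = {P \<in> proj_plane. i P \<noteq> 0}
         in finite Z \<and> (\<Sum>P\<in>Z. i P) = enat (m * n)"
proof -
  let ?A = "map_poly3 to_ac A" and ?B = "map_poly3 to_ac B"
  have hom: "homogeneous m ?A" "homogeneous n ?B"
    using assms homogeneous_map_to_ac by blast+
  have "total_intersection ?A ?B (m * n)"
    by (rule total_intersection_coprime[OF hom coprime_map_to_ac[OF assms(3)]])
  then obtain \<iota> where \<iota>: "\<And>P. P \<in> proj_plane \<Longrightarrow> fscale.codim (local_ideal P ?A ?B) (\<iota> P) (loc P)"
    "finite {P \<in> proj_plane. \<iota> P \<noteq> 0}" "(\<Sum>P | P \<in> proj_plane \<and> \<iota> P \<noteq> 0. \<iota> P) = m * n"
    unfolding total_intersection_def by blast
  have i: "intersection_mult P ?A ?B = enat (\<iota> P)" if "P \<in> proj_plane" for P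
    by (rule intersection_mult_eqI[OF that hom \<iota>(1)[OF that]])
  then have Z: "{P \<in> proj_plane. intersection_mult P ?A ?B \<noteq> 0} = {P \<in> proj_plane. \<iota> P \<noteq> 0}"
    by (auto simp: zero_enat_def)
  have "(\<Sum>P | P \<in> proj_plane \<and> \<iota> P \<noteq> 0. intersection_mult P ?A ?B) =
      (\<Sum>P | P \<in> proj_plane \<and> \<iota> P \<noteq> 0. enat (\<iota> P))"
    by (rule sum.cong) (auto simp: i)
  then show ?thesis
    unfolding Let_def Z using \<iota> by (simp add: sum_enat)
qed

end
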